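(* Consider the following two discrete problems. (S) Second-order-in-time scheme: find $U_h\in Q_h^{p_t}(Q_T)$ such that $U_h(\cdot,0)=U_{0,h_x}$ in $\Omega$ and $$-(\partial_tU_h,\partial_tW_h)_{L^2(Q_T)}+(c^2\nabla_xU_h,\nabla_x\Pi_{h_t}W_h)_{L^2(Q_T)}+(g(U_h),\Pi_{h_t}W_h)_{L^2(Q_T)}=(F,\Pi_{h_t}W_h)_{L^2(Q_T)}+(V_{0,h_x},W_h(\cdot,0))_{L^2(\Omega)}$$ for all $W_h\in Q_{h,\bullet,0}^{p_t}(Q_T)$. (F) First-order-in-time scheme: find $\widetilde U_h,\widetilde V_h\in Q_h^{p_t}(Q_T)$ such that $\widetilde U_h(\cdot,0)=U_{0,h_x}$, $\widetilde V_h(\cdot,0)=V_{0,h_x}$ in $\Omega$, and $$(\partial_t\widetilde U_h,\chi_h)_{L^2(Q_T)}-(\widetilde V_h,\chi_h)_{L^2(Q_T)}=0,$$ $$(\partial_t\widetilde V_h,\lambda_h)_{L^2(Q_T)}+(c^2\nabla_x\widetilde U_h,\nabla_x\lambda_h)_{L^2(Q_T)}+(g(\widetilde U_h),\lambda_h)_{L^2(Q_T)}=(F,\lambda_h)_{L^2(Q_T)}$$ for all $\chi_h,\lambda_h\in\partial_tQ_h^{p_t}(Q_T)$. If $(\widetilde U_h,\widetilde V_h)$ is a solution of (F), then $U_h=\widetilde U_h$ is a solution of (S). Conversely, if $U_h$ is a solution of (S), then the pair $(\widetilde U_h,\widetilde V_h)\in Q_h^{p_t}(Q_T)\times Q_h^{p_t}(Q_T)$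 with $\widetilde U_h=U_h$ and $\widetilde V_h$ such that $\Pi_{h_t}\widetilde V_h=\partial_tU_h$ and $\widetilde V_h(\cdot,0)=V_{0,h_x}$ is a solution of (F).
   Context: $\Omega\subset\mathbb R^d$ ($d\in\{1,2,3\}$) is a (bounded) polytopal Lipschitz domain, $T>0$, $Q_T=\Omega\times(0,T)$, $c\in C(\overline\Omega)$ with $c(x)\ge c_0>0$ for all $x\in\Omega$, and $U_0\in H^1_0(\Omega)$, $V_0\in L^2(\Omega)$, $F\in L^1(0,T;L^2(\Omega))$. For $F$, $(F,W)_{L^2(Q_T)}$ means $\int_0^T(F(\cdot,t),W(\cdot,t))_{L^2(\Omega)}\,dt$. The nonlinearity $g:\mathbb R\to\mathbb R$ is continuous with $g(0)=0$. $S_{h_x}(\Omega)\subset H^1_0(\Omega)$ is a space of piecewise polynomial functions of degree at most $p_x\ge1$ on a shape-regular conforming simplicial mesh of $\Omega$ with mesh size $h_x$. For nodes $0=t_0<t_1<\dots<t_{N_t}=T$ and an integer $p_t\ge1$, $S_{h_t}^{p_t}(0,T)$ is the space of continuous functions on $[0,T]$ that are polynomials of degree at most $p_t$ on each $[t_{i-1},t_i]$; $S_{h_t,\bullet,0}^{p_t}(0,T)$ is its subspace of functions vanishing at $t=T$; $\partial_tS_{h_t}^{p_t}(0,T)$ is the space of derivatives of its elements (discontinuous piecewise polynomials of degree at most $p_t-1$). Set $Q_h^{p_t}(Q_T)=S_{h_x}(\Omega)\otimes S_{h_t}^{p_t}(0,T)$, $\partial_tQ_h^{p_t}(Q_T)=S_{h_x}(\Omega)\otimes\partial_tS_{h_t}^{p_t}(0,T)$,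 $Q_{h,\bullet,0}^{p_t}(Q_T)=S_{h_x}(\Omega)\otimes S_{h_t,\bullet,0}^{p_t}(0,T)$. $\Pi_{h_t}:L^2(Q_T)\to L^2(\Omega)\otimes\partial_tS_{h_t}^{p_t}(0,T)$ is the $L^2$-orthogonal projection in time: $(\Pi_{h_t}U,\partial_tW)_{L^2(Q_T)}=(U,\partial_tW)_{L^2(Q_T)}$ for all $W\in L^2(\Omega)\otimes S_{h_t}^{p_t}(0,T)$. $U_{0,h_x},V_{0,h_x}\in S_{h_x}(\Omega)$ are defined by $(c^2\nabla_xU_{0,h_x},\nabla_xW)_{L^2(\Omega)}=(c^2\nabla_xU_0,\nabla_xW)_{L^2(\Omega)}$ and $(V_{0,h_x},W)_{L^2(\Omega)}=(V_0,W)_{L^2(\Omega)}$ for all $W\in S_{h_x}(\Omega)$. *)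

theory Defs
  imports "HOL-Analysis.Analysis" "HOL-Computational_Algebra.Polynomial"
begin

section \<open>Lebesgue and Sobolev spaces\<close>

text \<open>
  Elements of \<open>L\<^sup>2(D)\<close> are represented by functions; two of them denote the same element iff they
  agree almost everywhere on \<open>D\<close>.
\<close>

definition L2 :: "'a::euclidean_space set \<Rightarrow> ('a \<Rightarrow> 'b::euclidean_space) set" where
  "L2 D = {u. u \<in> borel_measurable (lebesgue_on D) \<and> integrable (lebesgue_on D) (\<lambda>x. (norm (u x))\<^sup>2)}"

definition l2_inner ::
    "'a::euclidean_space set \<Rightarrow> ('a \<Rightarrow> 'b::euclidean_space) \<Rightarrow> ('a \<Rightarrow> 'b) \<Rightarrow> real" where
  "l2_inner D u v = (\<integral>x. u x \<bullet> v x \<partial>lebesgue_on D)"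

definition l2_norm :: "'a::euclidean_space set \<Rightarrow> ('a \<Rightarrow> 'b::euclidean_space) \<Rightarrow> real" where
  "l2_norm D u = sqrt (l2_inner D u u)"

primrec Ck :: "nat \<Rightarrow> ('a::euclidean_space \<Rightarrow> real) \<Rightarrow> bool" where
  "Ck 0 f \<longleftrightarrow> continuous_on UNIV f"
| "Ck (Suc k) f \<longleftrightarrow> (\<forall>x. f differentiable (at x)) \<and>
     (\<forall>b\<in>Basis. Ck k (\<lambda>x. frechet_derivative f (at x) b))"

definition test_functions :: "'a::euclidean_space set \<Rightarrow> ('a \<Rightarrow> real) set" where
  "test_functions D = {\<phi>. (\<forall>k. Ck k \<phi>) \<and>
     compact (closure {x. \<phi> x \<noteq> 0}) \<and> closure {x. \<phi> x \<noteq> 0} \<subseteq> D}"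

text \<open>\<open>v\<close> is the weak derivative of \<open>u\<close> on the open set \<open>D\<close> in direction \<open>b\<close>.\<close>

definition weak_deriv ::
    "'a::euclidean_space set \<Rightarrow> 'a \<Rightarrow> ('a \<Rightarrow> real) \<Rightarrow> ('a \<Rightarrow> real) \<Rightarrow> bool" where
  "weak_deriv D b u v \<longleftrightarrow>
     (\<forall>\<phi>\<in>test_functions D. l2_inner D u (\<lambda>x. frechet_derivative \<phi> (at x) b) = - l2_inner D v \<phi>)"

definition has_weak_gradient ::
    "'a::euclidean_space set \<Rightarrow> ('a \<Rightarrow> real) \<Rightarrow> ('a \<Rightarrow> 'a) \<Rightarrow> bool" where
  "has_weak_gradient D u G \<longleftrightarrow> G \<in> L2 D \<and> (\<forall>b\<in>Basis. weak_deriv D b u (\<lambda>x. G x \<bullet> b))"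

text \<open>
  Weak gradients are unique up to null sets, so the choice below only fixes a representative; it is
  immaterial for every integral in which the gradient occurs.
\<close>

definition weak_gradient :: "'a::euclidean_space set \<Rightarrow> ('a \<Rightarrow> real) \<Rightarrow> 'a \<Rightarrow> 'a" where
  "weak_gradient D u = (SOME G. has_weak_gradient D u G)"

definition H1 :: "'a::euclidean_space set \<Rightarrow> ('a \<Rightarrow> real) set" where
  "H1 D = {u \<in> L2 D. \<exists>G. has_weak_gradient D u G}"

definition h1_norm :: "'a::euclidean_space set \<Rightarrow> ('a \<Rightarrow> real) \<Rightarrow> real" where
  "h1_norm D u = sqrt ((l2_norm D u)\<^sup>2 + (l2_norm D (weak_gradient D u))\<^sup>2)"

definition H10 :: "'a::euclidean_space set \<Rightarrow> ('a \<Rightarrow> real) set" where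
  "H10 D = {u \<in> H1 D. \<exists>\<phi>. (\<forall>n. \<phi> n \<in> test_functions D) \<and>
     (\<lambda>n. h1_norm D (\<lambda>x. u x - \<phi> n x)) \<longlonglongrightarrow> 0}"


section \<open>Domain and spatial discretization\<close>

text \<open>
  Near each boundary point the domain is the strict subgraph, in some direction \<open>\<nu>\<close>, of a Lipschitz
  function on the hyperplane orthogonal to \<open>\<nu>\<close>.
\<close>

definition lipschitz_boundary :: "'a::euclidean_space set \<Rightarrow> bool" where
  "lipschitz_boundary D \<longleftrightarrow> (\<forall>x\<in>frontier D. \<exists>r>0. \<exists>\<nu> L \<gamma>. norm \<nu> = 1 \<and>
     L-lipschitz_on {z. z \<bullet> \<nu> = 0} \<gamma> \<and>
     D \<inter> ball x r =
       {y \<in> ball x r. (y - x) \<bullet> \<nu> < (\<gamma> :: 'a \<Rightarrow> real) ((y - x) - ((y - x) \<bullet> \<nu>) *\<^sub>R \<nu>)})"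

definition polytopal_lipschitz_domain :: "'a::euclidean_space set \<Rightarrow> bool" where
  "polytopal_lipschitz_domain D \<longleftrightarrow> D \<noteq> {} \<and> open D \<and> connected D \<and> bounded D \<and>
     lipschitz_boundary D \<and>
     (\<exists>\<P>. finite \<P> \<and> (\<forall>P\<in>\<P>. polytope P) \<and> closure D = \<Union>\<P>)"

definition inradius :: "'a::euclidean_space set \<Rightarrow> real" where
  "inradius K = Sup {r. \<exists>x. cball x r \<subseteq> K}"

text \<open>
  The library's \<^const>\<open>triangulation\<close> requires any two simplices to meet in a common (possibly
  empty) face, i.e. it is conforming. The number \<open>\<sigma>\<close> is the shape-regularity constant.
\<close>

definition simplicial_mesh ::
    "'a::euclidean_space set \<Rightarrow> real \<Rightarrow> real \<Rightarrow> 'a set set \<Rightarrow> bool" where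
  "simplicial_mesh D \<sigma> h \<K> \<longleftrightarrow> triangulation \<K> \<and> (\<forall>K\<in>\<K>. int DIM('a) simplex K) \<and>
     \<Union>\<K> = closure D \<and> (\<forall>K\<in>\<K>. diameter K \<le> \<sigma> * inradius K) \<and> h = Max (diameter ` \<K>)"

definition polynomials_upto :: "nat \<Rightarrow> (real^'d \<Rightarrow> real) set" where
  "polynomials_upto k = {p. \<exists>a :: ('d \<Rightarrow> nat) \<Rightarrow> real.
     p = (\<lambda>x. \<Sum>\<alpha> | (\<Sum>i\<in>UNIV. \<alpha> i) \<le> k. a \<alpha> * (\<Prod>i\<in>UNIV. x $ i ^ \<alpha> i))}"

text \<open>
  A conforming space of piecewise polynomials: any linear subspace of the piecewise polynomials of
  degree at most \<open>k\<close> contained in \<open>H\<^sup>1\<^sub>0\<close> (in particular the space of all of them).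
\<close>

definition piecewise_polynomial_space ::
    "(real^'d) set \<Rightarrow> (real^'d) set set \<Rightarrow> nat \<Rightarrow> (real^'d \<Rightarrow> real) set \<Rightarrow> bool" where
  "piecewise_polynomial_space D \<K> k S \<longleftrightarrow>
     (\<lambda>x. 0) \<in> S \<and> (\<forall>u\<in>S. \<forall>v\<in>S. (\<lambda>x. u x + v x) \<in> S) \<and> (\<forall>a. \<forall>u\<in>S. (\<lambda>x. a * u x) \<in> S) \<and>
     S \<subseteq> H10 D \<and>
     (\<forall>u\<in>S. \<forall>K\<in>\<K>. \<exists>p\<in>polynomials_upto k. AE x in lebesgue_on K. u x = p x)"


section \<open>Temporal discretization and space-time functions\<close>

text \<open>The nodes are \<open>\<tau> 0 < \<dots> < \<tau> N\<close>.\<close>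

definition St :: "(nat \<Rightarrow> real) \<Rightarrow> nat \<Rightarrow> nat \<Rightarrow> (real \<Rightarrow> real) set" where
  "St \<tau> N p = {\<psi>. continuous_on {\<tau> 0..\<tau> N} \<psi> \<and>
     (\<forall>i\<in>{1..N}. \<exists>q. degree q \<le> p \<and> (\<forall>t\<in>{\<tau> (i - 1)..\<tau> i}. \<psi> t = poly q t))}"

definition St0 :: "(nat \<Rightarrow> real) \<Rightarrow> nat \<Rightarrow> nat \<Rightarrow> (real \<Rightarrow> real) set" where
  "St0 \<tau> N p = {\<psi> \<in> St \<tau> N p. \<psi> (\<tau> N) = 0}"

text \<open>Derivatives are taken away from the nodes; the values at the nodes (a null set) are arbitrary.\<close>

definition dSt :: "(nat \<Rightarrow> real) \<Rightarrow> nat \<Rightarrow> nat \<Rightarrow> (real \<Rightarrow> real) set" where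
  "dSt \<tau> N p = {\<eta>. \<exists>\<psi>\<in>St \<tau> N p. \<forall>i\<in>{1..N}. \<forall>t\<in>{\<tau> (i - 1)<..<\<tau> i}.
     (\<psi> has_real_derivative \<eta> t) (at t)}"

definition tensor ::
    "('a \<Rightarrow> real) set \<Rightarrow> (real \<Rightarrow> real) set \<Rightarrow> ('a \<times> real \<Rightarrow> real) set" where
  "tensor A B = {U. \<exists>(n::nat) \<phi> \<psi>. (\<forall>i<n. \<phi> i \<in> A \<and> \<psi> i \<in> B) \<and>
     U = (\<lambda>(x, t). \<Sum>i<n. \<phi> i x * \<psi> i t)}"

definition cylinder :: "'a set \<Rightarrow> real \<Rightarrow> ('a \<times> real) set" where
  "cylinder D T = D \<times> {0<..<T}"

definition time_deriv :: "('a \<times> real \<Rightarrow> real) \<Rightarrow> 'a \<times> real \<Rightarrow> real" where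
  "time_deriv U = (\<lambda>(x, t). deriv (\<lambda>s. U (x, s)) t)"

text \<open>The weak spatial gradient on the space-time cylinder; compare \<^const>\<open>weak_gradient\<close>.\<close>

definition gradient_x ::
    "'a::euclidean_space set \<Rightarrow> real \<Rightarrow> ('a \<times> real \<Rightarrow> real) \<Rightarrow> 'a \<times> real \<Rightarrow> 'a" where
  "gradient_x D T U = (SOME G. G \<in> L2 (cylinder D T) \<and>
     (\<forall>b\<in>Basis. weak_deriv (cylinder D T) (b, 0) U (\<lambda>z. G z \<bullet> b)))"

text \<open>
  The temporal projection. As \<^term>\<open>dSt \<tau> N p\<close> is finite dimensional up to null sets, the algebraic
  tensor product with \<open>L\<^sup>2(D)\<close> is already complete and the projection exists; it is unique up to
  null sets.
\<close>

definition time_proj ::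
    "'a::euclidean_space set \<Rightarrow> real \<Rightarrow> (nat \<Rightarrow> real) \<Rightarrow> nat \<Rightarrow> nat
       \<Rightarrow> ('a \<times> real \<Rightarrow> real) \<Rightarrow> 'a \<times> real \<Rightarrow> real" where
  "time_proj D T \<tau> N p U = (SOME P. P \<in> tensor (L2 D) (dSt \<tau> N p) \<and>
     (\<forall>W\<in>tensor (L2 D) (St \<tau> N p).
        l2_inner (cylinder D T) P (time_deriv W) = l2_inner (cylinder D T) U (time_deriv W)))"

text \<open>
  \<open>L\<^sup>1(0,T;L\<^sup>2(D))\<close>: since \<open>L\<^sup>2(D)\<close> is separable, Bochner measurable maps into it correspond to
  jointly measurable functions with square integrable time slices.
\<close>

definition L1L2 :: "'a::euclidean_space set \<Rightarrow> real \<Rightarrow> ('a \<times> real \<Rightarrow> real) set" where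
  "L1L2 D T = {F. F \<in> borel_measurable (lebesgue_on (cylinder D T)) \<and>
     (AE t in lebesgue_on {0<..<T}. (\<lambda>x. F (x, t)) \<in> L2 D) \<and>
     integrable (lebesgue_on {0<..<T}) (\<lambda>t. l2_norm D (\<lambda>x. F (x, t)))}"

definition l1l2_pairing ::
    "'a::euclidean_space set \<Rightarrow> real \<Rightarrow> ('a \<times> real \<Rightarrow> real) \<Rightarrow> ('a \<times> real \<Rightarrow> real) \<Rightarrow> real" where
  "l1l2_pairing D T F W =
     (\<integral>t. l2_inner D (\<lambda>x. F (x, t)) (\<lambda>x. W (x, t)) \<partial>lebesgue_on {0<..<T})"


section \<open>The two schemes\<close>

definition second_order_solution ::
    "(real^'d) set \<Rightarrow> real \<Rightarrow> (nat \<Rightarrow> real) \<Rightarrow> nat \<Rightarrow> nat \<Rightarrow> (real^'d \<Rightarrow> real) set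
       \<Rightarrow> (real^'d \<Rightarrow> real) \<Rightarrow> (real \<Rightarrow> real) \<Rightarrow> ((real^'d) \<times> real \<Rightarrow> real)
       \<Rightarrow> (real^'d \<Rightarrow> real) \<Rightarrow> (real^'d \<Rightarrow> real) \<Rightarrow> ((real^'d) \<times> real \<Rightarrow> real) \<Rightarrow> bool" where
  "second_order_solution \<Omega> T \<tau> N p S c g F U0h V0h U \<longleftrightarrow>
     U \<in> tensor S (St \<tau> N p) \<and>
     (AE x in lebesgue_on \<Omega>. U (x, 0) = U0h x) \<and>
     (\<forall>W\<in>tensor S (St0 \<tau> N p).
        - l2_inner (cylinder \<Omega> T) (time_deriv U) (time_deriv W)
        + l2_inner (cylinder \<Omega> T) (\<lambda>z. (c (fst z))\<^sup>2 *\<^sub>R gradient_x \<Omega> T U z)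
            (gradient_x \<Omega> T (time_proj \<Omega> T \<tau> N p W))
        + l2_inner (cylinder \<Omega> T) (\<lambda>z. g (U z)) (time_proj \<Omega> T \<tau> N p W)
        = l1l2_pairing \<Omega> T F (time_proj \<Omega> T \<tau> N p W)
        + l2_inner \<Omega> V0h (\<lambda>x. W (x, 0)))"

definition first_order_solution ::
    "(real^'d) set \<Rightarrow> real \<Rightarrow> (nat \<Rightarrow> real) \<Rightarrow> nat \<Rightarrow> nat \<Rightarrow> (real^'d \<Rightarrow> real) set
       \<Rightarrow> (real^'d \<Rightarrow> real) \<Rightarrow> (real \<Rightarrow> real) \<Rightarrow> ((real^'d) \<times> real \<Rightarrow> real)
       \<Rightarrow> (real^'d \<Rightarrow> real) \<Rightarrow> (real^'d \<Rightarrow> real)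
       \<Rightarrow> ((real^'d) \<times> real \<Rightarrow> real) \<Rightarrow> ((real^'d) \<times> real \<Rightarrow> real) \<Rightarrow> bool" where
  "first_order_solution \<Omega> T \<tau> N p S c g F U0h V0h U V \<longleftrightarrow>
     U \<in> tensor S (St \<tau> N p) \<and> V \<in> tensor S (St \<tau> N p) \<and>
     (AE x in lebesgue_on \<Omega>. U (x, 0) = U0h x) \<and>
     (AE x in lebesgue_on \<Omega>. V (x, 0) = V0h x) \<and>
     (\<forall>\<eta>\<in>tensor S (dSt \<tau> N p).
        l2_inner (cylinder \<Omega> T) (time_deriv U) \<eta> - l2_inner (cylinder \<Omega> T) V \<eta> = 0) \<and>
     (\<forall>\<mu>\<in>tensor S (dSt \<tau> N p).
        l2_inner (cylinder \<Omega> T) (time_deriv V) \<mu>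
        + l2_inner (cylinder \<Omega> T) (\<lambda>z. (c (fst z))\<^sup>2 *\<^sub>R gradient_x \<Omega> T U z) (gradient_x \<Omega> T \<mu>)
        + l2_inner (cylinder \<Omega> T) (\<lambda>z. g (U z)) \<mu>
        = l1l2_pairing \<Omega> T F \<mu>)"

definition reconstructed_velocity ::
    "(real^'d) set \<Rightarrow> real \<Rightarrow> (nat \<Rightarrow> real) \<Rightarrow> nat \<Rightarrow> nat \<Rightarrow> (real^'d \<Rightarrow> real) set
       \<Rightarrow> (real^'d \<Rightarrow> real) \<Rightarrow> ((real^'d) \<times> real \<Rightarrow> real) \<Rightarrow> ((real^'d) \<times> real \<Rightarrow> real) \<Rightarrow> bool" where
  "reconstructed_velocity \<Omega> T \<tau> N p S V0h U V \<longleftrightarrow>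
     V \<in> tensor S (St \<tau> N p) \<and>
     (AE z in lebesgue_on (cylinder \<Omega> T). time_proj \<Omega> T \<tau> N p V z = time_deriv U z) \<and>
     (AE x in lebesgue_on \<Omega>. V (x, 0) = V0h x)"

end

theory Submission
  imports Defs
begin

text \<open>
  Testing the first order scheme with \<open>\<Pi>W\<close> gives the second order scheme tested with \<open>W\<close>, and every
  admissible test function of the first order scheme is such a \<open>\<Pi>W\<close>. In detail: let \<open>V\<close> satisfy the
  first equation, i.e. \<open>(\<partial>\<^sub>tU, \<eta>) = (V, \<eta>)\<close> for all \<open>\<eta>\<close>, which says \<open>\<Pi>V = \<partial>\<^sub>tU\<close>, and let
  \<open>V(0) = V\<^sub>0\<close>. For \<open>W\<close> with \<open>W(T) = 0\<close>, the function \<open>\<partial>\<^sub>tW\<close> is an admissible \<open>\<eta>\<close>, so integration by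
  parts in time yields
  \<open>-(\<partial>\<^sub>tU, \<partial>\<^sub>tW) = -(V, \<partial>\<^sub>tW) = (\<partial>\<^sub>tV, W) + (V\<^sub>0, W(0)) = (\<partial>\<^sub>tV, \<Pi>W) + (V\<^sub>0, W(0))\<close>;
  the last step uses that \<open>\<partial>\<^sub>tV\<close> lies in the range of \<open>\<Pi>\<close>. This is \<open>second_order_term\<close>.
  The remaining terms of the two schemes are literally the same functional of \<open>\<Pi>W\<close>, so the two
  equations are equivalent for each \<open>W\<close>.

  What remains is linear algebra in the time variable. The central fact concerns a single element
  \<open>[a, b]\<close>: a polynomial \<open>q\<close> of degree at most \<open>p\<close> is determined by \<open>q(a)\<close> and its moments against
  polynomials of degree less than \<open>p\<close>, and these data can be prescribed freely
  (\<open>poly_reconstruction\<close>, \<open>poly_reconstruction_unique\<close>). Indeed \<open>q = q(a) + (t - a) s\<close> with \<open>s\<close> of degree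
  less than \<open>p\<close>, and \<open>(s, m) \<mapsto> \<integral> (t - a) s m\<close> is a scalar product. Advancing from element to element
  shows that \<open>V\<close> exists and is unique (\<open>St_reconstruction\<close>, \<open>St_orthogonal_eq_0\<close>). It also yields an
  \<open>\<omega>\<close> with \<open>\<omega>(0) = 1\<close> that is orthogonal to the discontinuous space; since \<open>0 = 2 (\<omega>, \<omega>') = \<omega>(T)\<^sup>2 - 1\<close>,
  a multiple of \<open>\<omega>\<close> corrects any terminal value, hence \<open>\<Pi>\<close> maps the functions vanishing at \<open>T\<close> onto
  the discontinuous space (\<open>St0_lift\<close>).

  These statements extend to the space-time cylinder because the scalar product of elementary tensors
  factorizes (\<open>l2_inner_tensor\<close>). Every term of the schemes is invariant under changes of the test
  function on null sets, so the choice of a representative of \<open>\<Pi>W\<close> is immaterial.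
\<close>

section \<open>Null sets and integrals on products\<close>

text \<open>
  Lebesgue measure is complete, so measurability transfers to functions that agree almost everywhere;
  if both functions fail to be integrable, both integrals are 0 by convention. Hence the scalar products
  below may be rewritten almost everywhere even where integrability is unknown.
\<close>
lemma integral_cong_AE_lebesgue_on:
  fixes f g :: "'a::euclidean_space \<Rightarrow> real"
  assumes D: "D \<in> sets lebesgue" and eq: "AE x in lebesgue_on D. f x = g x"
  shows "integrable (lebesgue_on D) f \<longleftrightarrow> integrable (lebesgue_on D) g"
    and "integral\<^sup>L (lebesgue_on D) f = integral\<^sup>L (lebesgue_on D) g"
    and "f \<in> borel_measurable (lebesgue_on D) \<longleftrightarrow> g \<in> borel_measurable (lebesgue_on D)"
proof -
  have ae: "AE x in lebesgue. indicator D x *\<^sub>R f x = indicator D x *\<^sub>R g x"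
    using eq D by (subst (asm) AE_restrict_space_iff) (auto simp: indicator_def elim!: AE_mp)
  have D': "D \<inter> space lebesgue \<in> sets lebesgue"
    using D by simp
  show meas: "f \<in> borel_measurable (lebesgue_on D) \<longleftrightarrow> g \<in> borel_measurable (lebesgue_on D)"
    unfolding borel_measurable_restrict_space_iff[OF D']
    using borel_measurable_AE[OF _ ae] borel_measurable_AE[OF _ AE_symmetric[OF ae]] by blast
  show int: "integrable (lebesgue_on D) f \<longleftrightarrow> integrable (lebesgue_on D) g"
    using meas eq integrable_cong_AE[of f "lebesgue_on D" g] borel_measurable_integrable by blast
  show "integral\<^sup>L (lebesgue_on D) f = integral\<^sup>L (lebesgue_on D) g"
  proof (cases "integrable (lebesgue_on D) f")
    case True
    then show ?thesis
      using meas eq by (intro integral_cong_AE) auto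
  next
    case False
    then show ?thesis
      using int by (simp add: not_integrable_integral_eq)
  qed
qed

text \<open>
  Lebesgue measure on a product is the completion of the product of the Borel-Lebesgue measures, so the
  claim reduces to the Borel case. There the order of the quantifiers is exchanged by swapping the two
  coordinates.
\<close>
lemma AE_lebesgue_pair:
  fixes P :: "'a::euclidean_space \<times> 'b::euclidean_space \<Rightarrow> bool"
  assumes "AE z in lebesgue. P z"
  shows "AE x in lebesgue. AE y in lebesgue. P (x, y)"
    and "AE y in lebesgue. AE x in lebesgue. P (x, y)"
proof -
  have ae: "AE z in lborel \<Otimes>\<^sub>M lborel. P z"
    using assms unfolding AE_completion_iff lborel_prod .
  show "AE x in lebesgue. AE y in lebesgue. P (x, y)"
    using lborel_pair.AE_pair[OF ae] by (simp add: AE_completion_iff)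
  have "AE z in lborel \<Otimes>\<^sub>M lborel. P (snd z, fst z)"
  proof -
    obtain N where N: "N \<in> null_sets (lborel \<Otimes>\<^sub>M lborel)" "{z. \<not> P z} \<subseteq> N"
      using ae by (auto simp: eventually_ae_filter space_pair_measure)
    have "AE z in distr (lborel \<Otimes>\<^sub>M lborel) (lborel \<Otimes>\<^sub>M lborel) (\<lambda>(x, y). (y, x)). z \<notin> N"
      using N(1) by (subst lborel_pair.distr_pair_swap[symmetric]) (rule AE_not_in)
    then have "AE z in lborel \<Otimes>\<^sub>M lborel. (case z of (x, y) \<Rightarrow> (y, x)) \<notin> N"
      by (rule AE_distrD[rotated]) (rule measurable_pair_swap')
    then show ?thesis
      by (rule eventually_mono) (use N(2) in \<open>auto split: prod.splits\<close>)
  qed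
  then show "AE y in lebesgue. AE x in lebesgue. P (x, y)"
    using lborel_pair.AE_pair[of "\<lambda>z. P (snd z, fst z)"] by (simp add: AE_completion_iff)
qed

lemma AE_lebesgue_fst:
  fixes P :: "'a::euclidean_space \<Rightarrow> bool"
  assumes "AE x in lebesgue. P x"
  shows "AE z in lebesgue :: ('a \<times> 'b::euclidean_space) measure. P (fst z)"
proof -
  obtain N where N: "N \<in> null_sets lborel" "{x. \<not> P x} \<subseteq> N"
    using assms unfolding AE_completion_iff by (auto simp: eventually_ae_filter)
  have "N \<times> UNIV \<in> null_sets (lborel \<Otimes>\<^sub>M (lborel :: 'b measure))"
    using lborel.times_in_null_sets1[OF N(1), of UNIV] by simp
  then have "AE z in lborel :: ('a \<times> 'b) measure. z \<notin> N \<times> UNIV"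
    by (metis AE_not_in lborel_prod)
  then show ?thesis
    unfolding AE_completion_iff by (rule eventually_mono) (use N(2) in auto)
qed

lemma AE_lebesgue_snd:
  fixes P :: "'b::euclidean_space \<Rightarrow> bool"
  assumes "AE x in lebesgue. P x"
  shows "AE z in lebesgue :: ('a::euclidean_space \<times> 'b) measure. P (snd z)"
proof -
  obtain N where N: "N \<in> null_sets lborel" "{x. \<not> P x} \<subseteq> N"
    using assms unfolding AE_completion_iff by (auto simp: eventually_ae_filter)
  have "UNIV \<times> N \<in> null_sets ((lborel :: 'a measure) \<Otimes>\<^sub>M lborel)"
    using lborel.times_in_null_sets2[OF _ N(1), of UNIV lborel] by simp
  then have "AE z in lborel :: ('a \<times> 'b) measure. z \<notin> UNIV \<times> N"
    by (metis AE_not_in lborel_prod)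
  then show ?thesis
    unfolding AE_completion_iff by (rule eventually_mono) (use N(2) in auto)
qed

lemma AE_lebesgue_on_iff: "open A \<Longrightarrow> (AE x in lebesgue_on A. P x) \<longleftrightarrow> (AE x in lebesgue. x \<in> A \<longrightarrow> P x)"
  for A :: "'a::euclidean_space set"
  by (rule AE_restrict_space_iff) simp

lemma AE_Times_slices:
  fixes A :: "'a::euclidean_space set" and B :: "'b::euclidean_space set"
  assumes A: "open A" and B: "open B" and ae: "AE z in lebesgue_on (A \<times> B). P z"
  shows "AE x in lebesgue_on A. AE y in lebesgue_on B. P (x, y)"
    and "AE y in lebesgue_on B. AE x in lebesgue_on A. P (x, y)"
proof -
  have ae': "AE z in lebesgue. z \<in> A \<times> B \<longrightarrow> P z"
    using ae by (simp add: AE_lebesgue_on_iff[OF open_Times[OF A B]])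
  show "AE x in lebesgue_on A. AE y in lebesgue_on B. P (x, y)"
    unfolding AE_lebesgue_on_iff[OF A] AE_lebesgue_on_iff[OF B]
    using AE_lebesgue_pair(1)[OF ae'] by eventually_elim auto
  show "AE y in lebesgue_on B. AE x in lebesgue_on A. P (x, y)"
    unfolding AE_lebesgue_on_iff[OF A] AE_lebesgue_on_iff[OF B]
    using AE_lebesgue_pair(2)[OF ae'] by eventually_elim auto
qed

lemma AE_Times_fst:
  fixes A :: "'a::euclidean_space set" and B :: "'b::euclidean_space set"
  assumes A: "open A" and B: "open B" and ae: "AE x in lebesgue_on A. P x"
  shows "AE z in lebesgue_on (A \<times> B). P (fst z)"
proof -
  have "AE z in lebesgue :: ('a \<times> 'b) measure. fst z \<in> A \<longrightarrow> P (fst z)"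
    using ae unfolding AE_lebesgue_on_iff[OF A] by (rule AE_lebesgue_fst)
  then show ?thesis
    unfolding AE_lebesgue_on_iff[OF open_Times[OF A B]] by eventually_elim auto
qed

lemma AE_Times_snd:
  fixes A :: "'a::euclidean_space set" and B :: "'b::euclidean_space set"
  assumes A: "open A" and B: "open B" and ae: "AE y in lebesgue_on B. P y"
  shows "AE z in lebesgue_on (A \<times> B). P (snd z)"
proof -
  have "AE z in lebesgue :: ('a \<times> 'b) measure. snd z \<in> B \<longrightarrow> P (snd z)"
    using ae unfolding AE_lebesgue_on_iff[OF B] by (rule AE_lebesgue_snd)
  then show ?thesis
    unfolding AE_lebesgue_on_iff[OF open_Times[OF A B]] by eventually_elim auto
qed

text \<open>
  Both factors are replaced by Borel representatives, to which the theorem of Fubini for the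
  Borel-Lebesgue measure applies.
\<close>
lemma lebesgue_product_integral:
  fixes f :: "'a::euclidean_space \<Rightarrow> real" and h :: "'b::euclidean_space \<Rightarrow> real"
  assumes f: "integrable lebesgue f" and h: "integrable lebesgue h"
  shows "integrable lebesgue (\<lambda>z. f (fst z) * h (snd z))"
    and "(\<integral>z. f (fst z) * h (snd z) \<partial>lebesgue) = integral\<^sup>L lebesgue f * integral\<^sup>L lebesgue h"
proof -
  obtain f' where f': "f' \<in> borel_measurable lborel" "AE x in lborel. f x = f' x"
    using f completion_ex_borel_measurable_real[of f lborel] by auto
  obtain h' where h': "h' \<in> borel_measurable lborel" "AE x in lborel. h x = h' x"
    using h completion_ex_borel_measurable_real[of h lborel] by auto
  note [measurable] = f'(1) h'(1)
  have ae_f: "AE x in lebesgue. f x = f' x" and ae_h: "AE x in lebesgue. h x = h' x"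
    using f'(2) h'(2) by (simp_all add: AE_completion_iff)
  have mf: "f' \<in> borel_measurable lebesgue" and mh: "h' \<in> borel_measurable lebesgue"
    using f'(1) h'(1) by (simp_all add: measurable_completion)
  have if': "integrable lborel f'"
    using f f'(1) ae_f mf integrable_cong_AE[of f lebesgue f'] integrable_completion[of f' lborel] by auto
  have ih': "integrable lborel h'"
    using h h'(1) ae_h mh integrable_cong_AE[of h lebesgue h'] integrable_completion[of h' lborel] by auto
  have I: "integrable (lborel \<Otimes>\<^sub>M lborel) (\<lambda>(x, y). f' x * h' y)"
  proof (rule lborel_pair.Fubini_integrable)
    show "(\<lambda>(x, y). f' x * h' y) \<in> borel_measurable (lborel \<Otimes>\<^sub>M lborel)"
      by measurable
    show "integrable lborel (\<lambda>x. \<integral>y. norm (case (x, y) of (x, y) \<Rightarrow> f' x * h' y) \<partial>lborel)"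
      using if' by (simp add: abs_mult)
    show "AE x in lborel. integrable lborel (\<lambda>y. case (x, y) of (x, y) \<Rightarrow> f' x * h' y)"
      using ih' by simp
  qed
  have E: "(\<integral>z. (case z of (x, y) \<Rightarrow> f' x * h' y) \<partial>(lborel \<Otimes>\<^sub>M lborel))
      = integral\<^sup>L lborel f' * integral\<^sup>L lborel h'"
    using lborel_pair.integral_fst'[OF I] by simp
  define k where "k = (\<lambda>z :: 'a \<times> 'b. f' (fst z) * h' (snd z))"
  have k: "integrable lborel k" "integral\<^sup>L lborel k = integral\<^sup>L lborel f' * integral\<^sup>L lborel h'"
    using I E by (simp_all add: k_def lborel_prod case_prod_beta')
  have ae: "AE z in lebesgue. f (fst z) * h (snd z) = k z"
    using AE_lebesgue_fst[OF ae_f] AE_lebesgue_snd[OF ae_h]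
    by eventually_elim (simp add: k_def)
  have "integrable lebesgue k" "integral\<^sup>L lebesgue k = integral\<^sup>L lborel k"
    using k(1) by (simp_all add: integrable_completion integral_completion)
  moreover have "integral\<^sup>L lebesgue f = integral\<^sup>L lborel f'"
    using f f'(1) ae_f mf integral_cong_AE[of f lebesgue f'] integral_completion[of f' lborel] by auto
  moreover have "integral\<^sup>L lebesgue h = integral\<^sup>L lborel h'"
    using h h'(1) ae_h mh integral_cong_AE[of h lebesgue h'] integral_completion[of h' lborel] by auto
  moreover note integral_cong_AE_lebesgue_on(1,2)[of UNIV "\<lambda>z. f (fst z) * h (snd z)" k,
      unfolded lebesgue_on_UNIV_eq, OF _ ae]
  ultimately show "integrable lebesgue (\<lambda>z. f (fst z) * h (snd z))"
    and "(\<integral>z. f (fst z) * h (snd z) \<partial>lebesgue) = integral\<^sup>L lebesgue f * integral\<^sup>L lebesgue h"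
    using k(2) by simp_all
qed

lemma borel_measurable_lebesgue_fst:
  fixes f :: "'a::euclidean_space \<Rightarrow> real"
  assumes "f \<in> borel_measurable lebesgue"
  shows "(\<lambda>z. f (fst z)) \<in> borel_measurable (lebesgue :: ('a \<times> 'b::euclidean_space) measure)"
proof -
  obtain f' where f': "f' \<in> borel_measurable lborel" "AE x in lborel. f x = f' x"
    using assms completion_ex_borel_measurable_real[of f lborel] by auto
  have "(\<lambda>z. f' (fst z)) \<in> borel_measurable (lborel :: ('a \<times> 'b) measure)"
    using f'(1) unfolding lborel_prod[symmetric] by measurable
  then have "(\<lambda>z. f' (fst z)) \<in> borel_measurable (lebesgue :: ('a \<times> 'b) measure)"
    by (rule measurable_completion)
  moreover have "AE z in lebesgue :: ('a \<times> 'b) measure. f' (fst z) = f (fst z)"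
    using f'(2) by (intro AE_lebesgue_fst[of "\<lambda>x. f' x = f x"]) (auto simp: AE_completion_iff elim: AE_mp)
  ultimately show ?thesis
    by (rule borel_measurable_AE)
qed

lemma borel_measurable_lebesgue_snd:
  fixes f :: "'b::euclidean_space \<Rightarrow> real"
  assumes "f \<in> borel_measurable lebesgue"
  shows "(\<lambda>z. f (snd z)) \<in> borel_measurable (lebesgue :: ('a::euclidean_space \<times> 'b) measure)"
proof -
  obtain f' where f': "f' \<in> borel_measurable lborel" "AE x in lborel. f x = f' x"
    using assms completion_ex_borel_measurable_real[of f lborel] by auto
  have "(\<lambda>z. f' (snd z)) \<in> borel_measurable (lborel :: ('a \<times> 'b) measure)"
    using f'(1) unfolding lborel_prod[symmetric] by measurable
  then have "(\<lambda>z. f' (snd z)) \<in> borel_measurable (lebesgue :: ('a \<times> 'b) measure)"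
    by (rule measurable_completion)
  moreover have "AE z in lebesgue :: ('a \<times> 'b) measure. f' (snd z) = f (snd z)"
    using f'(2) by (intro AE_lebesgue_snd[of "\<lambda>x. f' x = f x"]) (auto simp: AE_completion_iff elim: AE_mp)
  ultimately show ?thesis
    by (rule borel_measurable_AE)
qed

section \<open>The space of square integrable functions\<close>

lemma l2_inner_real: "l2_inner D u v = (\<integral>x. u x * v x \<partial>lebesgue_on D)"
  for u v :: "'a::euclidean_space \<Rightarrow> real"
  by (simp add: l2_inner_def)

lemma L2_real: "u \<in> L2 D \<longleftrightarrow> u \<in> borel_measurable (lebesgue_on D) \<and> integrable (lebesgue_on D) (\<lambda>x. (u x)\<^sup>2)"
  for u :: "'a::euclidean_space \<Rightarrow> real"
  by (simp add: L2_def)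

lemma L2_mult_integrable:
  fixes u v :: "'a::euclidean_space \<Rightarrow> real"
  assumes "u \<in> L2 D" "v \<in> L2 D"
  shows "integrable (lebesgue_on D) (\<lambda>x. u x * v x)"
proof (rule Bochner_Integration.integrable_bound)
  show "integrable (lebesgue_on D) (\<lambda>x. (u x)\<^sup>2 + (v x)\<^sup>2)"
    using assms by (simp add: L2_real)
  show "(\<lambda>x. u x * v x) \<in> borel_measurable (lebesgue_on D)"
    using assms by (auto simp: L2_real intro: borel_measurable_times)
  have "\<bar>a * b\<bar> \<le> a\<^sup>2 + b\<^sup>2" for a b :: real
  proof -
    have "2 * (\<bar>a\<bar> * \<bar>b\<bar>) \<le> a\<^sup>2 + b\<^sup>2" "0 \<le> \<bar>a\<bar> * \<bar>b\<bar>"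
      using sum_squares_bound[of "\<bar>a\<bar>" "\<bar>b\<bar>"] by simp_all
    then show ?thesis
      unfolding abs_mult by linarith
  qed
  then show "AE x in lebesgue_on D. norm (u x * v x) \<le> norm ((u x)\<^sup>2 + (v x)\<^sup>2)"
    by (simp add: order_trans[OF _ abs_ge_self])
qed

lemma L2_add:
  fixes u v :: "'a::euclidean_space \<Rightarrow> real"
  assumes "u \<in> L2 D" "v \<in> L2 D"
  shows "(\<lambda>x. u x + v x) \<in> L2 D"
  using assms L2_mult_integrable[OF assms]
  by (auto simp: L2_real power2_sum mult.assoc intro: borel_measurable_add)

lemma L2_scale:
  fixes u :: "'a::euclidean_space \<Rightarrow> real"
  assumes "u \<in> L2 D"
  shows "(\<lambda>x. a * u x) \<in> L2 D"
  using assms by (auto simp: L2_real power_mult_distrib intro: borel_measurable_times)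

lemma L2_zero: "(\<lambda>x. 0 :: real) \<in> L2 D"
  by (simp add: L2_real)

lemma L2_sum:
  fixes u :: "'i \<Rightarrow> 'a::euclidean_space \<Rightarrow> real"
  assumes "\<And>i. i \<in> I \<Longrightarrow> u i \<in> L2 D"
  shows "(\<lambda>x. \<Sum>i\<in>I. u i x) \<in> L2 D"
  using assms by (induction I rule: infinite_finite_induct) (auto intro: L2_add L2_zero)

lemma l2_inner_cong_AE:
  fixes u v :: "'a::euclidean_space \<Rightarrow> 'b::euclidean_space"
  assumes "D \<in> sets lebesgue" "AE x in lebesgue_on D. u x = u' x" "AE x in lebesgue_on D. v x = v' x"
  shows "l2_inner D u v = l2_inner D u' v'"
proof -
  have "AE x in lebesgue_on D. u x \<bullet> v x = u' x \<bullet> v' x"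
    using assms(2,3) by eventually_elim simp
  then show ?thesis
    unfolding l2_inner_def by (rule integral_cong_AE_lebesgue_on(2)[OF assms(1)])
qed

lemma l2_inner_commute: "l2_inner D u v = l2_inner D v u"
  by (simp add: l2_inner_def inner_commute)

lemma l2_inner_sum:
  fixes u :: "'i \<Rightarrow> 'a::euclidean_space \<Rightarrow> real" and v :: "'j \<Rightarrow> 'a \<Rightarrow> real"
  assumes "\<And>i. i \<in> I \<Longrightarrow> u i \<in> L2 D" "\<And>j. j \<in> J \<Longrightarrow> v j \<in> L2 D"
  shows "l2_inner D (\<lambda>x. \<Sum>i\<in>I. u i x) (\<lambda>x. \<Sum>j\<in>J. v j x) = (\<Sum>i\<in>I. \<Sum>j\<in>J. l2_inner D (u i) (v j))"
  unfolding l2_inner_real sum_product using assms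
  by (simp add: L2_mult_integrable Bochner_Integration.integral_sum)

lemma l2_inner_scale:
  fixes u v :: "'a::euclidean_space \<Rightarrow> real"
  shows "l2_inner D (\<lambda>x. a * u x) (\<lambda>x. b * v x) = a * b * l2_inner D u v"
proof -
  have "(\<lambda>x. a * u x * (b * v x)) = (\<lambda>x. a * b * (u x * v x))"
    by (simp add: mult_ac)
  then show ?thesis
    unfolding l2_inner_real by (simp only: integral_mult_right_zero)
qed

lemma l2_inner_diff_left:
  fixes u v w :: "'a::euclidean_space \<Rightarrow> real"
  assumes "u \<in> L2 D" "v \<in> L2 D" "w \<in> L2 D"
  shows "l2_inner D (\<lambda>x. u x - v x) w = l2_inner D u w - l2_inner D v w"
  using assms by (simp add: l2_inner_real left_diff_distrib L2_mult_integrable)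

lemma l2_inner_self_eq_0:
  fixes u :: "'a::euclidean_space \<Rightarrow> real"
  assumes "u \<in> L2 D" "l2_inner D u u = 0"
  shows "AE x in lebesgue_on D. u x = 0"
proof -
  have "AE x in lebesgue_on D. u x * u x = 0"
    using assms L2_mult_integrable[OF assms(1,1)]
    by (subst integral_nonneg_eq_0_iff_AE[symmetric]) (auto simp: l2_inner_real)
  then show ?thesis by simp
qed

section \<open>Tensor products of square integrable functions\<close>

text \<open>
  The cylinder is a product set, so its indicator function splits and the square of the tensor product
  is again a tensor product, now of integrable functions.
\<close>
lemma tensor_product_L2:
  fixes \<phi> :: "'a::euclidean_space \<Rightarrow> real" and \<psi> :: "'b::euclidean_space \<Rightarrow> real"
  assumes D: "open D" and I: "open I" and "\<phi> \<in> L2 D" "\<psi> \<in> L2 I"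
  shows "(\<lambda>z. \<phi> (fst z) * \<psi> (snd z)) \<in> L2 (D \<times> I)"
proof -
  have ind: "indicator (D \<times> I) z = indicator D (fst z) * (indicator I (snd z) :: real)" for z
    by (cases z) (auto simp: indicator_def)
  have D': "D \<inter> space lebesgue \<in> sets lebesgue" and I': "I \<inter> space lebesgue \<in> sets lebesgue"
    and DI: "(D \<times> I) \<inter> space lebesgue \<in> sets lebesgue"
    using D I open_Times[OF D I] by simp_all
  have "(\<lambda>x. indicator D x *\<^sub>R \<phi> x) \<in> borel_measurable lebesgue"
    using assms(3) by (simp add: L2_real borel_measurable_restrict_space_iff[OF D'])
  moreover have "(\<lambda>x. indicator I x *\<^sub>R \<psi> x) \<in> borel_measurable lebesgue"
    using assms(4) by (simp add: L2_real borel_measurable_restrict_space_iff[OF I'])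
  ultimately have "(\<lambda>z. (indicator D (fst z) *\<^sub>R \<phi> (fst z)) * (indicator I (snd z) *\<^sub>R \<psi> (snd z)))
      \<in> borel_measurable (lebesgue :: ('a \<times> 'b) measure)"
    using borel_measurable_lebesgue_fst borel_measurable_lebesgue_snd by (intro borel_measurable_times) blast+
  then have 1: "(\<lambda>z. \<phi> (fst z) * \<psi> (snd z)) \<in> borel_measurable (lebesgue_on (D \<times> I))"
    by (subst borel_measurable_restrict_space_iff[OF DI]) (simp add: ind mult_ac)
  have "integrable lebesgue (\<lambda>x. indicator D x *\<^sub>R (\<phi> x)\<^sup>2)"
    using assms(3) by (simp add: L2_real integrable_restrict_space[OF D'])
  moreover have "integrable lebesgue (\<lambda>x. indicator I x *\<^sub>R (\<psi> x)\<^sup>2)"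
    using assms(4) by (simp add: L2_real integrable_restrict_space[OF I'])
  ultimately have "integrable lebesgue (\<lambda>z. (indicator D (fst z) *\<^sub>R (\<phi> (fst z))\<^sup>2) * (indicator I (snd z) *\<^sub>R (\<psi> (snd z))\<^sup>2))"
    by (rule lebesgue_product_integral)
  then have "integrable (lebesgue_on (D \<times> I)) (\<lambda>z. (\<phi> (fst z) * \<psi> (snd z))\<^sup>2)"
    by (subst integrable_restrict_space[OF DI]) (simp add: ind mult_ac power_mult_distrib)
  with 1 show ?thesis
    by (simp add: L2_real)
qed

lemma l2_inner_tensor_product:
  fixes \<phi> \<phi>' :: "'a::euclidean_space \<Rightarrow> real" and \<psi> \<psi>' :: "'b::euclidean_space \<Rightarrow> real"
  assumes D: "open D" and I: "open I" and "\<phi> \<in> L2 D" "\<phi>' \<in> L2 D" "\<psi> \<in> L2 I" "\<psi>' \<in> L2 I"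
  shows "l2_inner (D \<times> I) (\<lambda>z. \<phi> (fst z) * \<psi> (snd z)) (\<lambda>z. \<phi>' (fst z) * \<psi>' (snd z))
       = l2_inner D \<phi> \<phi>' * l2_inner I \<psi> \<psi>'"
proof -
  have ind: "indicator (D \<times> I) z = indicator D (fst z) * (indicator I (snd z) :: real)" for z
    by (cases z) (auto simp: indicator_def)
  have D': "D \<inter> space lebesgue \<in> sets lebesgue" and I': "I \<inter> space lebesgue \<in> sets lebesgue"
    and DI: "(D \<times> I) \<inter> space lebesgue \<in> sets lebesgue"
    using D I open_Times[OF D I] by simp_all
  have "integrable lebesgue (\<lambda>x. indicator D x *\<^sub>R (\<phi> x * \<phi>' x))"
    using L2_mult_integrable[OF assms(3,4)] by (simp add: integrable_restrict_space[OF D'])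
  moreover have "integrable lebesgue (\<lambda>x. indicator I x *\<^sub>R (\<psi> x * \<psi>' x))"
    using L2_mult_integrable[OF assms(5,6)] by (simp add: integrable_restrict_space[OF I'])
  ultimately have "(\<integral>z. (indicator D (fst z) *\<^sub>R (\<phi> (fst z) * \<phi>' (fst z))) * (indicator I (snd z) *\<^sub>R (\<psi> (snd z) * \<psi>' (snd z))) \<partial>lebesgue)
      = (\<integral>x. indicator D x *\<^sub>R (\<phi> x * \<phi>' x) \<partial>lebesgue) * (\<integral>x. indicator I x *\<^sub>R (\<psi> x * \<psi>' x) \<partial>lebesgue)"
    by (rule lebesgue_product_integral)
  then show ?thesis
    unfolding l2_inner_real integral_restrict_space[OF D'] integral_restrict_space[OF I'] integral_restrict_space[OF DI]
    by (simp add: ind mult_ac)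
qed

text \<open>
  Every orthogonality statement on the cylinder is reduced by this formula to one in the time variable.
\<close>
lemma l2_inner_tensor:
  fixes \<phi> :: "'i \<Rightarrow> 'a::euclidean_space \<Rightarrow> real" and \<psi> :: "'i \<Rightarrow> 'b::euclidean_space \<Rightarrow> real"
    and \<phi>' :: "'j \<Rightarrow> 'a::euclidean_space \<Rightarrow> real" and \<psi>' :: "'j \<Rightarrow> 'b::euclidean_space \<Rightarrow> real"
  assumes D: "open D" and I: "open I"
    and "\<And>i. i \<in> A \<Longrightarrow> \<phi> i \<in> L2 D" "\<And>i. i \<in> A \<Longrightarrow> \<psi> i \<in> L2 I"
    and "\<And>j. j \<in> B \<Longrightarrow> \<phi>' j \<in> L2 D" "\<And>j. j \<in> B \<Longrightarrow> \<psi>' j \<in> L2 I"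
  shows "l2_inner (D \<times> I) (\<lambda>z. \<Sum>i\<in>A. \<phi> i (fst z) * \<psi> i (snd z)) (\<lambda>z. \<Sum>j\<in>B. \<phi>' j (fst z) * \<psi>' j (snd z))
       = (\<Sum>i\<in>A. \<Sum>j\<in>B. l2_inner D (\<phi> i) (\<phi>' j) * l2_inner I (\<psi> i) (\<psi>' j))"
  by (simp add: l2_inner_sum l2_inner_tensor_product tensor_product_L2 assms)

lemma tensorE:
  assumes "U \<in> tensor A B"
  obtains n \<phi> \<psi> where "\<And>i. i \<in> {..<n::nat} \<Longrightarrow> \<phi> i \<in> A" "\<And>i. i \<in> {..<n} \<Longrightarrow> \<psi> i \<in> B"
    "U = (\<lambda>z. \<Sum>i<n. \<phi> i (fst z) * \<psi> i (snd z))"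
  using assms unfolding tensor_def by (auto simp: case_prod_beta')

lemma tensorI:
  assumes "\<And>i. i \<in> {..<n::nat} \<Longrightarrow> \<phi> i \<in> A" "\<And>i. i \<in> {..<n} \<Longrightarrow> \<psi> i \<in> B"
  shows "(\<lambda>z. \<Sum>i<n. \<phi> i (fst z) * \<psi> i (snd z)) \<in> tensor A B"
  unfolding tensor_def mem_Collect_eq
  by (rule exI[of _ n], rule exI[of _ \<phi>], rule exI[of _ \<psi>]) (use assms in auto)

lemma tensor_mono: "A \<subseteq> A' \<Longrightarrow> B \<subseteq> B' \<Longrightarrow> tensor A B \<subseteq> tensor A' B'"
  unfolding tensor_def by blast

lemma tensor_add:
  assumes "U \<in> tensor A B" "W \<in> tensor A B"
  shows "(\<lambda>z. U z + W z) \<in> tensor A B"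
proof -
  obtain n \<phi> \<psi> where U: "\<And>i. i \<in> {..<n::nat} \<Longrightarrow> \<phi> i \<in> A" "\<And>i. i \<in> {..<n} \<Longrightarrow> \<psi> i \<in> B"
    "U = (\<lambda>z. \<Sum>i<n. \<phi> i (fst z) * \<psi> i (snd z))"
    using tensorE[OF assms(1)] by metis
  obtain m \<phi>' \<psi>' where W: "\<And>i. i \<in> {..<m::nat} \<Longrightarrow> \<phi>' i \<in> A" "\<And>i. i \<in> {..<m} \<Longrightarrow> \<psi>' i \<in> B"
    "W = (\<lambda>z. \<Sum>i<m. \<phi>' i (fst z) * \<psi>' i (snd z))"
    using tensorE[OF assms(2)] by metis
  define \<Phi> where "\<Phi> i = (if i < n then \<phi> i else \<phi>' (i - n))" for i
  define \<Psi> where "\<Psi> i = (if i < n then \<psi> i else \<psi>' (i - n))" for i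
  have split: "(\<Sum>i<n+m. f i) = (\<Sum>i<n. f i) + (\<Sum>i<m. f (n + i))" for f :: "nat \<Rightarrow> real"
    by (induction m) auto
  have "(\<lambda>z. U z + W z) = (\<lambda>z. \<Sum>i<n+m. \<Phi> i (fst z) * \<Psi> i (snd z))"
    unfolding split U(3) W(3) by (simp add: \<Phi>_def \<Psi>_def)
  also have "\<dots> \<in> tensor A B"
    by (rule tensorI) (use U W in \<open>auto simp: \<Phi>_def \<Psi>_def\<close>)
  finally show ?thesis .
qed

lemma tensor_uminus:
  assumes "U \<in> tensor A B" and A: "\<And>\<phi>. \<phi> \<in> A \<Longrightarrow> (\<lambda>x. - \<phi> x) \<in> A"
  shows "(\<lambda>z. - U z) \<in> tensor A B"
proof -
  obtain n \<phi> \<psi> where U: "\<And>i. i \<in> {..<n::nat} \<Longrightarrow> \<phi> i \<in> A" "\<And>i. i \<in> {..<n} \<Longrightarrow> \<psi> i \<in> B"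
    "U = (\<lambda>z. \<Sum>i<n. \<phi> i (fst z) * \<psi> i (snd z))"
    using tensorE[OF assms(1)] by metis
  have "(\<lambda>z. - U z) = (\<lambda>z. \<Sum>i<n. (\<lambda>x. - \<phi> i x) (fst z) * \<psi> i (snd z))"
    by (simp add: U(3) sum_negf)
  also have "\<dots> \<in> tensor A B"
    by (rule tensorI[of n "\<lambda>i x. - \<phi> i x"]) (use U A in auto)
  finally show ?thesis .
qed

lemma tensor_L2:
  fixes U :: "'a::euclidean_space \<times> real \<Rightarrow> real"
  assumes "open D" "open I" "U \<in> tensor (L2 D) (L2 I)"
  shows "U \<in> L2 (D \<times> I)"
  using assms(3) by (rule tensorE) (auto intro!: L2_sum tensor_product_L2 assms(1,2))

section \<open>Polynomials on one time element\<close>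

text \<open>
  The polynomials of degree less than \<open>k\<close>; in contrast to a bound on \<^const>\<open>degree\<close>, the
  condition on the coefficients gives the zero space for \<open>k = 0\<close>.
\<close>
definition polys_below :: "nat \<Rightarrow> real poly set" where
  "polys_below k = {q. \<forall>i\<ge>k. coeff q i = 0}"

lemma polys_below_0: "polys_below 0 = {0}"
  by (auto simp: polys_below_def poly_eq_iff)

lemma polys_below_Suc: "q \<in> polys_below (Suc k) \<longleftrightarrow> degree q \<le> k"
  by (auto simp: polys_below_def Suc_le_eq intro!: degree_le coeff_eq_0)

definition poly_integral :: "real \<Rightarrow> real \<Rightarrow> real poly \<Rightarrow> real" where
  "poly_integral a b q = integral {a..b} (\<lambda>t. poly q t)"

lemma poly_integrable: "(\<lambda>t. poly q t) integrable_on {a..b}" for q :: "real poly"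
  by (intro integrable_continuous_real continuous_intros)

lemma poly_integral_add: "poly_integral a b (p + q) = poly_integral a b p + poly_integral a b q"
  using integral_add[OF poly_integrable[of p a b] poly_integrable[of q a b]] by (simp add: poly_integral_def)

lemma poly_integral_diff: "poly_integral a b (p - q) = poly_integral a b p - poly_integral a b q"
  using integral_diff[OF poly_integrable[of p a b] poly_integrable[of q a b]] by (simp add: poly_integral_def)

lemma poly_integral_smult: "poly_integral a b (smult c q) = c * poly_integral a b q"
  by (simp add: poly_integral_def)

lemma poly_integral_0: "poly_integral a b 0 = 0"
  by (simp add: poly_integral_def)

lemma poly_integral_weighted_square_eq_0:
  assumes "a < b" and w: "\<And>x. a < x \<Longrightarrow> x \<le> b \<Longrightarrow> poly w x > 0" "poly w a \<ge> 0"
    and "poly_integral a b (w * s * s) = 0"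
  shows "s = 0"
proof -
  have nn: "poly (w * s * s) x \<ge> 0" if "x \<in> {a..b}" for x
  proof -
    have "poly w x \<ge> 0"
      using that w(1)[of x] w(2) by (cases "x = a") auto
    then show ?thesis
      by (simp add: mult.assoc)
  qed
  have "continuous_on {a..b} (poly (w * s * s))"
    by (intro continuous_intros)
  moreover have "integral {a..b} (poly (w * s * s)) = 0"
    using assms(4) unfolding poly_integral_def .
  ultimately have "\<forall>x\<in>{a..b}. poly (w * s * s) x = 0"
    using integral_eq_0_iff[of a b "poly (w * s * s)"] \<open>a < b\<close> nn by blast
  then have "poly s x = 0" if "x \<in> {a<..<b}" for x
    using that w(1)[of x] by force
  then have "{a<..<b} \<subseteq> {x. poly s x = 0}"
    by auto
  then show ?thesis
    using poly_roots_finite[of s] infinite_Ioo[OF \<open>a < b\<close>] finite_subset by blast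
qed

text \<open>
  The weighted integral is positive definite on polynomials, so the moments of \<open>f\<close> are represented by a
  polynomial of the same degree bound. The induction on \<open>k\<close> is the Gram-Schmidt procedure: it adds a
  multiple of \<open>u\<close>, the monomial of degree \<open>k\<close> made orthogonal to all polynomials of smaller degree.
\<close>
lemma poly_weighted_riesz:
  assumes "a < b" and w: "\<And>x. a < x \<Longrightarrow> x \<le> b \<Longrightarrow> poly w x > 0" "poly w a \<ge> 0"
  shows "\<exists>s\<in>polys_below k. \<forall>m\<in>polys_below k. poly_integral a b ((w * s - f) * m) = 0"
proof (induction k arbitrary: f)
  case 0
  show ?case
    by (simp add: polys_below_0 poly_integral_0)
next
  case (Suc k)
  obtain r where r: "r \<in> polys_below k" "\<And>m. m \<in> polys_below k \<Longrightarrow> poly_integral a b ((w * r - w * monom 1 k) * m) = 0"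
    using Suc.IH[of "w * monom 1 k"] by blast
  obtain s where s: "s \<in> polys_below k" "\<And>m. m \<in> polys_below k \<Longrightarrow> poly_integral a b ((w * s - f) * m) = 0"
    using Suc.IH[of f] by blast
  \<comment> \<open>Monic of degree \<open>k\<close> and orthogonal to all polynomials of smaller degree.\<close>
  define u where "u = monom 1 k - r"
  have u_top: "coeff u k = 1" "\<And>i. i > k \<Longrightarrow> coeff u i = 0"
    using r(1) by (auto simp: u_def polys_below_def)
  have u_orth: "poly_integral a b (w * u * m) = 0" if "m \<in> polys_below k" for m
  proof -
    have "w * u * m = smult (-1) ((w * r - w * monom 1 k) * m)"
      by (simp add: u_def algebra_simps)
    then show ?thesis
      using r(2)[OF that] by (simp only: poly_integral_smult)
  qed
  have u_pos: "poly_integral a b (w * u * u) \<noteq> 0"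
    using poly_integral_weighted_square_eq_0[OF assms, of u] u_top(1) by auto
  \<comment> \<open>\<open>\<kappa>\<close> makes the residual of \<open>s + \<kappa> u\<close> orthogonal to \<open>u\<close> as well.\<close>
  define \<kappa> where "\<kappa> = - poly_integral a b ((w * s - f) * u) / poly_integral a b (w * u * u)"
  have "s + smult \<kappa> u \<in> polys_below (Suc k)"
    using s(1) u_top(2) by (auto simp: polys_below_def)
  moreover have "poly_integral a b ((w * (s + smult \<kappa> u) - f) * m) = 0" if m: "m \<in> polys_below (Suc k)" for m
  proof -
    define c where "c = coeff m k"
    define n where "n = m - smult c u"
    have n: "n \<in> polys_below k"
      unfolding polys_below_def mem_Collect_eq
    proof (intro allI impI)
      fix i assume "k \<le> i"
      then consider "i = k" | "Suc k \<le> i" by linarith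
      then show "coeff n i = 0"
        using m u_top by cases (auto simp: polys_below_def n_def c_def)
    qed
    have "m = n + smult c u"
      by (simp add: n_def)
    then have "(w * (s + smult \<kappa> u) - f) * m
        = (w * s - f) * n + smult \<kappa> (w * u * n) + smult c ((w * s - f) * u) + smult (c * \<kappa>) (w * u * u)"
      by (simp add: algebra_simps smult_add_right smult_diff_right)
    then have "poly_integral a b ((w * (s + smult \<kappa> u) - f) * m)
        = c * poly_integral a b ((w * s - f) * u) + c * \<kappa> * poly_integral a b (w * u * u)"
      using s(2)[OF n] u_orth[OF n] by (simp add: poly_integral_add poly_integral_smult)
    also have "\<dots> = 0"
      using u_pos by (simp add: \<kappa>_def)
    finally show ?thesis .
  qed
  ultimately show ?case
    by blast
qed

lemma poly_projection:
  assumes "a < b"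
  shows "\<exists>r\<in>polys_below k. \<forall>m\<in>polys_below k. poly_integral a b ((r - f) * m) = 0"
  using poly_weighted_riesz[OF assms, of 1 k f] by simp

text \<open>
  Also for \<open>k = 0\<close>, where both sides force \<open>s = 0\<close>.
\<close>
lemma linear_factor_polys_below:
  "degree ([:- a, 1:] * s) \<le> k \<longleftrightarrow> s \<in> polys_below k" for s :: "real poly"
proof (cases "s = 0")
  case False
  then have "degree ([:- a, 1:] * s) = Suc (degree s)"
    by (simp add: degree_mult_eq del: mult_pCons_left)
  then show ?thesis
    using False by (cases k) (simp_all add: polys_below_Suc polys_below_0 del: mult_pCons_left)
qed (simp add: polys_below_def)

text \<open>
  The ansatz \<open>q = \<alpha> + (t - a) s\<close> takes care of the value at \<open>a\<close> and turns the moment conditions into the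
  weighted problem for \<open>s\<close> with weight \<open>t - a\<close>.
\<close>
lemma poly_reconstruction:
  assumes "a < b"
  shows "\<exists>q. degree q \<le> k \<and> poly q a = \<alpha> \<and> (\<forall>m\<in>polys_below k. poly_integral a b ((q - f) * m) = 0)"
proof -
  obtain s where s: "s \<in> polys_below k"
    "\<And>m. m \<in> polys_below k \<Longrightarrow> poly_integral a b (([:- a, 1:] * s - (f - [:\<alpha>:])) * m) = 0"
    using poly_weighted_riesz[OF assms, of "[:- a, 1:]" k "f - [:\<alpha>:]"] by auto
  define q where "q = [:- a, 1:] * s + [:\<alpha>:]"
  have "degree q \<le> k"
    unfolding q_def using s(1) linear_factor_polys_below[of a s k] by (intro degree_add_le) auto
  moreover have "poly q a = \<alpha>"
    by (simp add: q_def)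
  moreover have "q - f = [:- a, 1:] * s - (f - [:\<alpha>:])"
    by (simp add: q_def)
  ultimately show ?thesis
    using s(2) by metis
qed

text \<open>
  As \<open>q = (t - a) s\<close>, the choice \<open>m = s\<close> makes the weighted square of \<open>s\<close> vanish.
\<close>
lemma poly_reconstruction_unique:
  assumes "a < b" "degree q \<le> k" "poly q a = 0" "\<And>m. m \<in> polys_below k \<Longrightarrow> poly_integral a b (q * m) = 0"
  shows "q = 0"
proof -
  obtain s where q: "q = [:- a, 1:] * s"
    using assms(3) by (auto simp: poly_eq_0_iff_dvd)
  then have "poly_integral a b ([:- a, 1:] * s * s) = 0"
    using assms(2,4) linear_factor_polys_below[of a s k] by simp
  then have "s = 0"
    by (rule poly_integral_weighted_square_eq_0[OF assms(1), rotated 2]) auto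
  then show ?thesis
    using q by simp
qed

lemma poly_antiderivative:
  assumes "q \<in> polys_below k"
  shows "\<exists>Q. degree Q \<le> k \<and> pderiv Q = q"
proof (intro exI conjI)
  let ?Q = "\<Sum>i<k. monom (coeff q i / (real i + 1)) (Suc i)"
  show "degree ?Q \<le> k"
    by (intro degree_sum_le) (auto intro: order_trans[OF degree_monom_le])
  have "pderiv ?Q = (\<Sum>i<k. monom (coeff q i) i)"
    using higher_pderiv_sum[of 1 "\<lambda>i. monom (coeff q i / (real i + 1)) (Suc i)" "{..<k}"]
    by (auto simp: pderiv_monom add.commute intro!: sum.cong)
  also have "\<dots> = q"
    using assms by (auto simp: poly_eq_iff coeff_sum polys_below_def not_less)
  finally show "pderiv ?Q = q" .
qed

lemma poly_integral_pderiv: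
  assumes "a \<le> b"
  shows "poly_integral a b (pderiv q) = poly q b - poly q a"
  unfolding poly_integral_def
  by (rule integral_unique, rule fundamental_theorem_of_calculus[OF assms])
    (auto simp: has_real_derivative_iff_has_vector_derivative[symmetric] intro!: derivative_eq_intros poly_DERIV DERIV_subset[OF poly_DERIV])

section \<open>Continuous piecewise polynomials in time\<close>

text \<open>
  If the problem \<open>R i\<close> on the element \<open>i\<close> can be solved for every initial value, then the solutions can
  be joined continuously: each element starts with the final value of the preceding one. This is used
  for antiderivatives and for the reconstruction from moments.
\<close>
lemma continuous_piecewise_glue:
  fixes \<tau> :: "nat \<Rightarrow> real"
  assumes "\<And>i. i < N \<Longrightarrow> \<tau> i < \<tau> (Suc i)"
    and "\<And>i \<beta>. i < N \<Longrightarrow> \<exists>q. poly q (\<tau> i) = \<beta> \<and> R (Suc i) q"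
  shows "\<exists>\<psi> e. continuous_on {\<tau> 0..\<tau> N} \<psi> \<and> \<psi> (\<tau> 0) = (\<alpha> :: real) \<and>
    (\<forall>i\<in>{1..N}. R i (e i) \<and> (\<forall>t\<in>{\<tau> (i - 1)..\<tau> i}. \<psi> t = poly (e i) t))"
  using assms
proof (induction N)
  case 0
  then show ?case
    by (intro exI[of _ "\<lambda>_. \<alpha>"]) auto
next
  case (Suc N)
  obtain \<psi> e where \<psi>: "continuous_on {\<tau> 0..\<tau> N} \<psi>" "\<psi> (\<tau> 0) = \<alpha>"
    and e: "\<And>i. i \<in> {1..N} \<Longrightarrow> R i (e i) \<and> (\<forall>t\<in>{\<tau> (i - 1)..\<tau> i}. \<psi> t = poly (e i) t)"
    using Suc.IH Suc.prems by (metis less_SucI)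
  obtain q where q: "poly q (\<tau> N) = \<psi> (\<tau> N)" "R (Suc N) q"
    using Suc.prems(2)[of N "\<psi> (\<tau> N)"] by auto
  have mono: "\<tau> i \<le> \<tau> j" if "i \<le> j" "j \<le> Suc N" for i j
    using that
  proof (induction j rule: dec_induct)
    case (step j)
    then show ?case
      using Suc.prems(1)[of j] by simp
  qed simp
  define \<psi>' where "\<psi>' t = (if t \<le> \<tau> N then \<psi> t else poly q t)" for t
  have "continuous_on {\<tau> 0..\<tau> (Suc N)} \<psi>'"
    unfolding \<psi>'_def
  proof (rule continuous_on_cases_le[where h = "\<lambda>t. t"])
    show "continuous_on {t \<in> {\<tau> 0..\<tau> (Suc N)}. t \<le> \<tau> N} \<psi>"
      by (rule continuous_on_subset[OF \<psi>(1)]) auto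
  qed (use q in \<open>auto intro!: continuous_intros\<close>)
  moreover have "\<psi>' (\<tau> 0) = \<alpha>"
    using \<psi>(2) mono[of 0 N] by (simp add: \<psi>'_def)
  moreover have "R i ((e(Suc N := q)) i) \<and> (\<forall>t\<in>{\<tau> (i - 1)..\<tau> i}. \<psi>' t = poly ((e(Suc N := q)) i) t)"
    if "i \<in> {1..Suc N}" for i
  proof (cases "i = Suc N")
    case True
    then show ?thesis
      using q by (auto simp: \<psi>'_def order_antisym)
  next
    case False
    then have "i \<in> {1..N}" "\<tau> i \<le> \<tau> N"
      using that mono[of i N] by auto
    then show ?thesis
      using e[of i] False by (auto simp: \<psi>'_def)
  qed
  ultimately show ?case
    by blast
qed

locale time_mesh =
  fixes \<tau> :: "nat \<Rightarrow> real" and N :: nat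
  assumes node_step: "i < N \<Longrightarrow> \<tau> i < \<tau> (Suc i)"
begin

abbreviation J :: "real set" where "J \<equiv> {\<tau> 0<..<\<tau> N}"

text \<open>
  The values at the nodes are left open, so that the notion covers both the continuous functions and
  their derivatives.
\<close>
definition pieces :: "(nat \<Rightarrow> real poly) \<Rightarrow> (real \<Rightarrow> real) \<Rightarrow> bool" where
  "pieces e \<psi> \<longleftrightarrow> (\<forall>i\<in>{1..N}. \<forall>t\<in>{\<tau> (i - 1)<..<\<tau> i}. \<psi> t = poly (e i) t)"

lemma node_mono:
  assumes "i \<le> j" "j \<le> N" shows "\<tau> i \<le> \<tau> j"
  using assms
proof (induction j rule: dec_induct)
  case (step j)
  then show ?case
    using node_step[of j] by simp
qed simp

lemma element_less: "i \<in> {1..N} \<Longrightarrow> \<tau> (i - 1) < \<tau> i"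
  using node_step[of "i - 1"] by auto

lemma element_subset: "i \<in> {1..N} \<Longrightarrow> {\<tau> (i - 1)..\<tau> i} \<subseteq> {\<tau> 0..\<tau> N}"
  using node_mono[of 0 "i - 1"] node_mono[of i N] by auto

lemma elements_disjoint:
  assumes "i \<in> {1..N}" "j \<in> {1..N}" "t \<in> {\<tau> (i - 1)<..<\<tau> i}" "t \<in> {\<tau> (j - 1)..\<tau> j}"
  shows "i = j"
proof (rule ccontr)
  assume "i \<noteq> j"
  then consider "i \<le> j - 1" | "j \<le> i - 1" by linarith
  then show False
  proof cases
    case 1
    then have "\<tau> i \<le> \<tau> (j - 1)"
      using assms(2) by (intro node_mono) auto
    then show False using assms(3,4) by simp
  next
    case 2
    then have "\<tau> j \<le> \<tau> (i - 1)"
      using assms(1) by (intro node_mono) auto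
    then show False using assms(3,4) by simp
  qed
qed

lemma element_of:
  assumes "t \<in> {\<tau> 0..\<tau> N}" "t \<notin> \<tau> ` {..N}"
  obtains i where "i \<in> {1..N}" "t \<in> {\<tau> (i - 1)<..<\<tau> i}"
proof -
  define i where "i = (LEAST i. t < \<tau> i)"
  have "t < \<tau> N"
    using assms by (auto simp: less_le)
  then have i: "t < \<tau> i" "i \<le> N"
    unfolding i_def by (auto intro: LeastI Least_le)
  have "i \<noteq> 0"
    using i(1) assms(1) by (auto intro: ccontr)
  then have "\<not> t < \<tau> (i - 1)"
    using not_less_Least[of "i - 1" "\<lambda>i. t < \<tau> i"] by (auto simp: i_def)
  moreover have "t \<noteq> \<tau> (i - 1)"
    using assms(2) i(2) by auto
  ultimately show thesis
    using that[of i] i \<open>i \<noteq> 0\<close> by auto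
qed

lemma AE_not_node: "AE t in lebesgue. t \<notin> \<tau> ` {..N}"
  by (intro AE_not_in negligible_iff_null_sets[THEN iffD1] negligible_finite) auto

lemma AE_mesh_iff: "(AE t in lebesgue_on J. P t) \<longleftrightarrow> (AE t in lebesgue. t \<in> J \<longrightarrow> P t)"
  by (rule AE_restrict_space_iff) auto

lemma AE_elements:
  assumes "\<And>i t. i \<in> {1..N} \<Longrightarrow> t \<in> {\<tau> (i - 1)<..<\<tau> i} \<Longrightarrow> P t"
  shows "AE t in lebesgue_on J. P t"
  unfolding AE_mesh_iff using AE_not_node
proof eventually_elim
  case (elim t)
  show ?case
  proof
    assume "t \<in> J"
    then obtain i where "i \<in> {1..N}" "t \<in> {\<tau> (i - 1)<..<\<tau> i}"
      using element_of[of t] elim by auto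
    then show "P t"
      by (rule assms)
  qed
qed

lemma pieces_mult: "pieces e \<psi> \<Longrightarrow> pieces f \<zeta> \<Longrightarrow> pieces (\<lambda>i. e i * f i) (\<lambda>t. \<psi> t * \<zeta> t)"
  by (simp add: pieces_def)

text \<open>
  Closed elements overlap only in nodes, and the integrals over them are those of the polynomials on
  compact intervals.
\<close>
lemma pieces_AE:
  assumes "pieces e \<psi>"
  shows "AE t in lebesgue. indicator J t *\<^sub>R \<psi> t = (\<Sum>i=1..N. indicator {\<tau> (i - 1)..\<tau> i} t *\<^sub>R poly (e i) t)"
  using AE_not_node
proof eventually_elim
  case (elim t)
  show ?case
  proof (cases "t \<in> J")
    case True
    then obtain i where i: "i \<in> {1..N}" "t \<in> {\<tau> (i - 1)<..<\<tau> i}"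
      using element_of[of t] elim by auto
    have "indicator {\<tau> (j - 1)..\<tau> j} t *\<^sub>R poly (e j) t = (if j = i then poly (e i) t else 0)"
      if "j \<in> {1..N}" for j
    proof (cases "t \<in> {\<tau> (j - 1)..\<tau> j}")
      case True
      then have "j = i"
        using elements_disjoint[OF i(1) that i(2)] by blast
      then show ?thesis using True by simp
    next
      case False
      then have "j \<noteq> i" using i by auto
      then show ?thesis using False by simp
    qed
    then have "(\<Sum>j=1..N. indicator {\<tau> (j - 1)..\<tau> j} t *\<^sub>R poly (e j) t) = poly (e i) t"
      using i(1) by simp
    then show ?thesis
      using True assms i by (simp add: pieces_def)
  next
    case False
    have "t \<notin> {\<tau> (i - 1)..\<tau> i}" if "i \<in> {1..N}" for i
    proof
      assume "t \<in> {\<tau> (i - 1)..\<tau> i}"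
      then have "t \<in> {\<tau> 0..\<tau> N}"
        using element_subset[OF that] by blast
      then have "t = \<tau> 0 \<or> t = \<tau> N"
        using False by auto
      then show False
        using elim by auto
    qed
    then have "(\<Sum>i=1..N. indicator {\<tau> (i - 1)..\<tau> i} t *\<^sub>R poly (e i) t) = 0"
      by (intro sum.neutral) (simp add: indicator_def)
    then show ?thesis
      using False by simp
  qed
qed

lemma pieces_integral:
  assumes "pieces e \<psi>"
  shows "integrable (lebesgue_on J) \<psi>"
    and "integral\<^sup>L (lebesgue_on J) \<psi> = (\<Sum>i=1..N. poly_integral (\<tau> (i - 1)) (\<tau> i) (e i))"
proof -
  have cl: "integrable (lebesgue_on {a..b}) (\<lambda>t. poly q t)" for a b and q :: "real poly"
    by (intro continuous_imp_integrable_real continuous_intros)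
  have int: "integrable lebesgue (\<lambda>t. indicator {a..b} t *\<^sub>R poly q t)"
    and val: "(\<integral>t. indicator {a..b} t *\<^sub>R poly q t \<partial>lebesgue) = poly_integral a b q" for a b and q :: "real poly"
    using cl[of a b q] lebesgue_integral_eq_integral[OF cl[of a b q]]
    by (simp_all add: integrable_restrict_space integral_restrict_space poly_integral_def)
  have J: "J \<inter> space lebesgue \<in> sets lebesgue"
    by simp
  have "(UNIV :: real set) \<in> sets lebesgue"
    by simp
  note ae = integral_cong_AE_lebesgue_on(1,2)[of UNIV, unfolded lebesgue_on_UNIV_eq, OF this pieces_AE[OF assms]]
  show "integrable (lebesgue_on J) \<psi>"
    unfolding integrable_restrict_space[OF J] ae(1) by (simp only: Bochner_Integration.integrable_sum int)
  show "integral\<^sup>L (lebesgue_on J) \<psi> = (\<Sum>i=1..N. poly_integral (\<tau> (i - 1)) (\<tau> i) (e i))"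
    unfolding integral_restrict_space[OF J] ae(2) by (simp only: Bochner_Integration.integral_sum int val)
qed

lemma pieces_L2:
  assumes "pieces e \<psi>" shows "\<psi> \<in> L2 J"
  using pieces_integral(1)[OF assms] pieces_integral(1)[OF pieces_mult[OF assms assms]]
  by (auto simp: L2_real power2_eq_square)

lemma pieces_l2_inner:
  assumes "pieces e \<psi>" "pieces f \<zeta>"
  shows "l2_inner J \<psi> \<zeta> = (\<Sum>i=1..N. poly_integral (\<tau> (i - 1)) (\<tau> i) (e i * f i))"
  using pieces_integral(2)[OF pieces_mult[OF assms]] by (simp add: l2_inner_real)

lemma St_piecesE:
  assumes "\<psi> \<in> St \<tau> N p"
  obtains e where "\<And>i. i \<in> {1..N} \<Longrightarrow> degree (e i) \<le> p"
    "\<And>i t. i \<in> {1..N} \<Longrightarrow> t \<in> {\<tau> (i - 1)..\<tau> i} \<Longrightarrow> \<psi> t = poly (e i) t" "pieces e \<psi>"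
proof -
  have "\<forall>i\<in>{1..N}. \<exists>q. degree q \<le> p \<and> (\<forall>t\<in>{\<tau> (i - 1)..\<tau> i}. \<psi> t = poly q t)"
    using assms by (simp add: St_def)
  from bchoice[OF this] obtain e where
    "\<forall>i\<in>{1..N}. degree (e i) \<le> p \<and> (\<forall>t\<in>{\<tau> (i - 1)..\<tau> i}. \<psi> t = poly (e i) t)" ..
  then show thesis
    by (intro that[of e]) (auto simp: pieces_def)
qed

lemma deriv_poly_pieces:
  assumes "pieces e \<psi>"
  shows "\<forall>i\<in>{1..N}. \<forall>t\<in>{\<tau> (i - 1)<..<\<tau> i}. (\<psi> has_real_derivative poly (pderiv (e i)) t) (at t)"
proof (intro ballI)
  fix i t
  assume i: "i \<in> {1..N}" "t \<in> {\<tau> (i - 1)<..<\<tau> i}"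
  show "(\<psi> has_real_derivative poly (pderiv (e i)) t) (at t)"
  proof (rule has_field_derivative_transform_within_open[OF poly_DERIV])
    show "open {\<tau> (i - 1)<..<\<tau> i}" "t \<in> {\<tau> (i - 1)<..<\<tau> i}"
      using i by auto
  qed (use assms i in \<open>auto simp: pieces_def\<close>)
qed

lemma pderiv_polys_below: "degree q \<le> p \<Longrightarrow> pderiv q \<in> polys_below p"
  by (auto simp: polys_below_def coeff_pderiv intro: coeff_eq_0)

lemma dSt_piecesE:
  assumes "\<eta> \<in> dSt \<tau> N p"
  obtains e where "\<And>i. i \<in> {1..N} \<Longrightarrow> e i \<in> polys_below p" "pieces e \<eta>"
proof -
  obtain \<psi> where \<psi>: "\<psi> \<in> St \<tau> N p"
    and der: "\<And>i t. i \<in> {1..N} \<Longrightarrow> t \<in> {\<tau> (i - 1)<..<\<tau> i} \<Longrightarrow> (\<psi> has_real_derivative \<eta> t) (at t)"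
    using assms by (auto simp: dSt_def)
  obtain e where e: "\<And>i. i \<in> {1..N} \<Longrightarrow> degree (e i) \<le> p" "pieces e \<psi>"
    using St_piecesE[OF \<psi>] by metis
  show thesis
  proof
    show "\<And>i. i \<in> {1..N} \<Longrightarrow> pderiv (e i) \<in> polys_below p"
      using e(1) pderiv_polys_below by blast
    show "pieces (\<lambda>i. pderiv (e i)) \<eta>"
      unfolding pieces_def using DERIV_unique[OF der] deriv_poly_pieces[OF e(2)] by blast
  qed
qed

text \<open>
  The antiderivatives of the polynomials \<open>e i\<close> are glued to a continuous function.
\<close>
lemma dStI:
  assumes "\<And>i. i \<in> {1..N} \<Longrightarrow> e i \<in> polys_below p" "pieces e \<eta>"
  shows "\<eta> \<in> dSt \<tau> N p"
proof -
  let ?R = "\<lambda>i q. i \<in> {1..N} \<longrightarrow> degree q \<le> p \<and> pderiv q = e i"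
  have ex: "\<exists>q. poly q (\<tau> i) = \<beta> \<and> ?R (Suc i) q" if "i < N" for i \<beta>
  proof -
    have "Suc i \<in> {1..N}"
      using that by simp
    then obtain Q where "degree Q \<le> p" "pderiv Q = e (Suc i)"
      using poly_antiderivative[OF assms(1)] by blast
    then show ?thesis
      by (intro exI[of _ "Q + [:\<beta> - poly Q (\<tau> i):]"]) (auto simp: pderiv_add pderiv_pCons intro: degree_add_le)
  qed
  obtain \<psi> f where \<psi>: "continuous_on {\<tau> 0..\<tau> N} \<psi>"
    and f: "\<And>i. i \<in> {1..N} \<Longrightarrow> ?R i (f i) \<and> (\<forall>t\<in>{\<tau> (i - 1)..\<tau> i}. \<psi> t = poly (f i) t)"
    using continuous_piecewise_glue[of N \<tau> ?R 0, OF node_step ex] by metis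
  have "\<psi> \<in> St \<tau> N p"
    unfolding St_def using \<psi> f by blast
  moreover have "pieces f \<psi>"
    using f by (auto simp: pieces_def)
  have "(\<psi> has_real_derivative \<eta> t) (at t)" if "i \<in> {1..N}" "t \<in> {\<tau> (i - 1)<..<\<tau> i}" for i t
  proof -
    have "(\<psi> has_real_derivative poly (pderiv (f i)) t) (at t)"
      using deriv_poly_pieces[OF \<open>pieces f \<psi>\<close>] that by blast
    moreover have "pderiv (f i) = e i" "\<eta> t = poly (e i) t"
      using f[OF that(1)] assms(2) that unfolding pieces_def by blast+
    ultimately show ?thesis
      by simp
  qed
  ultimately show ?thesis
    unfolding dSt_def by blast
qed

lemma deriv_pieces:
  assumes "pieces e \<psi>"
  shows "pieces (\<lambda>i. pderiv (e i)) (deriv \<psi>)"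
  using deriv_poly_pieces[OF assms] by (auto simp: pieces_def dest!: DERIV_imp_deriv)

lemma deriv_dSt: "\<psi> \<in> St \<tau> N p \<Longrightarrow> deriv \<psi> \<in> dSt \<tau> N p"
  using St_piecesE[of \<psi> p] by (metis dStI deriv_pieces pderiv_polys_below)

lemma St_differentiable:
  assumes "\<psi> \<in> St \<tau> N p" "i \<in> {1..N}" "t \<in> {\<tau> (i - 1)<..<\<tau> i}"
  shows "(\<psi> has_real_derivative deriv \<psi> t) (at t)"
  using St_piecesE[OF assms(1)] deriv_poly_pieces assms(2,3) by (metis DERIV_imp_deriv)

lemma St_L2: "St \<tau> N p \<subseteq> L2 J"
  using St_piecesE pieces_L2 by (metis subsetI)

lemma dSt_L2: "dSt \<tau> N p \<subseteq> L2 J"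
  using dSt_piecesE pieces_L2 by (metis subsetI)

lemma St_lincomb:
  assumes "\<psi> \<in> St \<tau> N p" "\<zeta> \<in> St \<tau> N p"
  shows "(\<lambda>t. \<psi> t + a * \<zeta> t) \<in> St \<tau> N p"
proof -
  obtain e where e: "\<And>i. i \<in> {1..N} \<Longrightarrow> degree (e i) \<le> p"
    "\<And>i t. i \<in> {1..N} \<Longrightarrow> t \<in> {\<tau> (i - 1)..\<tau> i} \<Longrightarrow> \<psi> t = poly (e i) t"
    using St_piecesE[OF assms(1)] by metis
  obtain f where f: "\<And>i. i \<in> {1..N} \<Longrightarrow> degree (f i) \<le> p"
    "\<And>i t. i \<in> {1..N} \<Longrightarrow> t \<in> {\<tau> (i - 1)..\<tau> i} \<Longrightarrow> \<zeta> t = poly (f i) t"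
    using St_piecesE[OF assms(2)] by metis
  have "\<exists>q. degree q \<le> p \<and> (\<forall>t\<in>{\<tau> (i - 1)..\<tau> i}. \<psi> t + a * \<zeta> t = poly q t)" if "i \<in> {1..N}" for i
    by (rule exI[of _ "e i + smult a (f i)"])
      (use e[OF that] f[OF that] in \<open>auto intro!: degree_add_le order_trans[OF degree_smult_le]\<close>)
  moreover have "continuous_on {\<tau> 0..\<tau> N} (\<lambda>t. \<psi> t + a * \<zeta> t)"
    using assms by (auto simp: St_def intro!: continuous_intros)
  ultimately show ?thesis
    by (simp add: St_def)
qed

text \<open>
  On each element this is the fundamental theorem of calculus for the product polynomial; by continuity
  the contributions of the inner nodes cancel.
\<close>
lemma St_integration_by_parts:
  assumes "\<psi> \<in> St \<tau> N p" "\<zeta> \<in> St \<tau> N p"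
  shows "l2_inner J (deriv \<psi>) \<zeta> + l2_inner J \<psi> (deriv \<zeta>) = \<psi> (\<tau> N) * \<zeta> (\<tau> N) - \<psi> (\<tau> 0) * \<zeta> (\<tau> 0)"
proof -
  obtain e where e: "\<And>i t. i \<in> {1..N} \<Longrightarrow> t \<in> {\<tau> (i - 1)..\<tau> i} \<Longrightarrow> \<psi> t = poly (e i) t" "pieces e \<psi>"
    using St_piecesE[OF assms(1)] by metis
  obtain f where f: "\<And>i t. i \<in> {1..N} \<Longrightarrow> t \<in> {\<tau> (i - 1)..\<tau> i} \<Longrightarrow> \<zeta> t = poly (f i) t" "pieces f \<zeta>"
    using St_piecesE[OF assms(2)] by metis
  have "l2_inner J (deriv \<psi>) \<zeta> + l2_inner J \<psi> (deriv \<zeta>)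
      = (\<Sum>i=1..N. poly_integral (\<tau> (i - 1)) (\<tau> i) (pderiv (e i) * f i) + poly_integral (\<tau> (i - 1)) (\<tau> i) (e i * pderiv (f i)))"
    using pieces_l2_inner[OF deriv_pieces[OF e(2)] f(2)] pieces_l2_inner[OF e(2) deriv_pieces[OF f(2)]]
    by (simp add: sum.distrib)
  also have "\<dots> = (\<Sum>i=1..N. \<psi> (\<tau> i) * \<zeta> (\<tau> i) - \<psi> (\<tau> (i - 1)) * \<zeta> (\<tau> (i - 1)))"
  proof (rule sum.cong[OF refl])
    fix i assume i: "i \<in> {1..N}"
    have "poly_integral (\<tau> (i - 1)) (\<tau> i) (pderiv (e i) * f i) + poly_integral (\<tau> (i - 1)) (\<tau> i) (e i * pderiv (f i))
        = poly_integral (\<tau> (i - 1)) (\<tau> i) (pderiv (e i * f i))"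
      by (simp add: poly_integral_add pderiv_mult mult.commute add.commute)
    also have "\<dots> = \<psi> (\<tau> i) * \<zeta> (\<tau> i) - \<psi> (\<tau> (i - 1)) * \<zeta> (\<tau> (i - 1))"
      using element_less[OF i] e(1)[OF i] f(1)[OF i] by (simp add: poly_integral_pderiv)
    finally show "poly_integral (\<tau> (i - 1)) (\<tau> i) (pderiv (e i) * f i) + poly_integral (\<tau> (i - 1)) (\<tau> i) (e i * pderiv (f i))
        = \<psi> (\<tau> i) * \<zeta> (\<tau> i) - \<psi> (\<tau> (i - 1)) * \<zeta> (\<tau> (i - 1))" .
  qed
  also have "\<dots> = \<psi> (\<tau> N) * \<zeta> (\<tau> N) - \<psi> (\<tau> 0) * \<zeta> (\<tau> 0)"
    using sum_telescope''[of 0 N "\<lambda>i. \<psi> (\<tau> i) * \<zeta> (\<tau> i)"] by (simp add: atLeastSucAtMost_greaterThanAtMost)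
  finally show ?thesis .
qed

text \<open>
  The discontinuous space has no coupling between elements: agreement of the moments on each element
  is enough.
\<close>
lemma orthogonal_dStI:
  assumes "pieces e \<psi>" "pieces f \<eta>"
    and "\<And>i m. i \<in> {1..N} \<Longrightarrow> m \<in> polys_below p \<Longrightarrow> poly_integral (\<tau> (i - 1)) (\<tau> i) ((e i - f i) * m) = 0"
    and "\<eta>' \<in> dSt \<tau> N p"
  shows "l2_inner J \<psi> \<eta>' = l2_inner J \<eta> \<eta>'"
proof -
  obtain m where m: "\<And>i. i \<in> {1..N} \<Longrightarrow> m i \<in> polys_below p" "pieces m \<eta>'"
    using dSt_piecesE[OF assms(4)] by metis
  have "poly_integral (\<tau> (i - 1)) (\<tau> i) (e i * m i) = poly_integral (\<tau> (i - 1)) (\<tau> i) (f i * m i)" if "i \<in> {1..N}" for i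
    using assms(3)[OF that m(1)[OF that]] by (simp add: left_diff_distrib poly_integral_diff)
  then show ?thesis
    unfolding pieces_l2_inner[OF assms(1) m(2)] pieces_l2_inner[OF assms(2) m(2)] by (rule sum.cong[OF refl])
qed

definition piecewise :: "(nat \<Rightarrow> real poly) \<Rightarrow> real \<Rightarrow> real" where
  "piecewise e t = (\<Sum>i=1..N. if t \<in> {\<tau> (i - 1)<..<\<tau> i} then poly (e i) t else 0)"

lemma pieces_piecewise: "pieces e (piecewise e)"
  unfolding pieces_def
proof (intro ballI)
  fix i t
  assume i: "i \<in> {1..N}" "t \<in> {\<tau> (i - 1)<..<\<tau> i}"
  have "(if t \<in> {\<tau> (j - 1)<..<\<tau> j} then poly (e j) t else 0) = (if j = i then poly (e i) t else 0)"
    if "j \<in> {1..N}" for j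
  proof (cases "t \<in> {\<tau> (j - 1)<..<\<tau> j}")
    case True
    then have "t \<in> {\<tau> (j - 1)..\<tau> j}" by simp
    then have "j = i"
      using elements_disjoint[OF i(1) that i(2)] by blast
    then show ?thesis using True by simp
  next
    case False
    then have "j \<noteq> i" using i by blast
    with False show ?thesis by (simp only: if_False)
  qed
  then show "piecewise e t = poly (e i) t"
    unfolding piecewise_def using i(1) by simp
qed

section \<open>Projection and reconstruction in time\<close>

lemma dSt_projection_exists:
  assumes "\<psi> \<in> St \<tau> N p"
  shows "\<exists>\<pi>\<in>dSt \<tau> N p. \<forall>\<eta>\<in>dSt \<tau> N p. l2_inner J \<pi> \<eta> = l2_inner J \<psi> \<eta>"
proof -
  obtain e where e: "pieces e \<psi>"
    using St_piecesE[OF assms] by metis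
  have "\<forall>i\<in>{1..N}. \<exists>r. r \<in> polys_below p \<and> (\<forall>m\<in>polys_below p. poly_integral (\<tau> (i - 1)) (\<tau> i) ((r - e i) * m) = 0)"
    using poly_projection[OF element_less] by blast
  from bchoice[OF this] obtain r where r: "\<And>i. i \<in> {1..N} \<Longrightarrow> r i \<in> polys_below p"
    "\<And>i m. i \<in> {1..N} \<Longrightarrow> m \<in> polys_below p \<Longrightarrow> poly_integral (\<tau> (i - 1)) (\<tau> i) ((r i - e i) * m) = 0"
    by blast
  show ?thesis
  proof (intro bexI ballI)
    show "piecewise r \<in> dSt \<tau> N p"
      by (rule dStI[OF r(1) pieces_piecewise])
    show "l2_inner J (piecewise r) \<eta> = l2_inner J \<psi> \<eta>" if "\<eta> \<in> dSt \<tau> N p" for \<eta>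
      by (rule orthogonal_dStI[OF pieces_piecewise e r(2) that])
  qed
qed

text \<open>
  The reconstruction in a single time variable: any element of the discontinuous space is the projection
  of a continuous function with prescribed initial value.
\<close>
lemma St_reconstruction:
  assumes "\<eta> \<in> dSt \<tau> N p"
  shows "\<exists>\<psi>\<in>St \<tau> N p. \<psi> (\<tau> 0) = \<alpha> \<and> (\<forall>\<eta>'\<in>dSt \<tau> N p. l2_inner J \<psi> \<eta>' = l2_inner J \<eta> \<eta>')"
proof -
  obtain f where f: "pieces f \<eta>"
    using dSt_piecesE[OF assms] by metis
  let ?R = "\<lambda>i q. degree q \<le> p \<and> (\<forall>m\<in>polys_below p. poly_integral (\<tau> (i - 1)) (\<tau> i) ((q - f i) * m) = 0)"
  have ex: "\<exists>q. poly q (\<tau> i) = \<beta> \<and> ?R (Suc i) q" if "i < N" for i \<beta>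
    using poly_reconstruction[OF node_step[OF that], of p \<beta> "f (Suc i)"] by auto
  obtain \<psi> e where \<psi>: "continuous_on {\<tau> 0..\<tau> N} \<psi>" "\<psi> (\<tau> 0) = \<alpha>"
    and e: "\<And>i. i \<in> {1..N} \<Longrightarrow> ?R i (e i) \<and> (\<forall>t\<in>{\<tau> (i - 1)..\<tau> i}. \<psi> t = poly (e i) t)"
    using continuous_piecewise_glue[of N \<tau> ?R \<alpha>, OF node_step ex] by metis
  have "\<psi> \<in> St \<tau> N p"
    unfolding St_def using \<psi> e by blast
  moreover have "pieces e \<psi>"
    using e by (auto simp: pieces_def)
  then have "l2_inner J \<psi> \<eta>' = l2_inner J \<eta> \<eta>'" if "\<eta>' \<in> dSt \<tau> N p" for \<eta>'
    by (rule orthogonal_dStI[OF _ f _ that]) (use e in blast)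
  ultimately show ?thesis
    using \<psi>(2) by blast
qed

text \<open>
  Testing with functions supported in one element localizes the orthogonality. Then \<open>\<psi>\<close> vanishes on one
  element after the other, because on each of them it starts with the value 0.
\<close>
lemma St_orthogonal_eq_0:
  assumes \<psi>: "\<psi> \<in> St \<tau> N p" "\<psi> (\<tau> 0) = 0"
    and orth: "\<And>\<eta>. \<eta> \<in> dSt \<tau> N p \<Longrightarrow> l2_inner J \<psi> \<eta> = 0"
    and t: "t \<in> {\<tau> 0..\<tau> N}"
  shows "\<psi> t = 0"
proof -
  obtain e where e: "\<And>i. i \<in> {1..N} \<Longrightarrow> degree (e i) \<le> p"
    "\<And>i t. i \<in> {1..N} \<Longrightarrow> t \<in> {\<tau> (i - 1)..\<tau> i} \<Longrightarrow> \<psi> t = poly (e i) t" "pieces e \<psi>"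
    using St_piecesE[OF \<psi>(1)] by metis
  have local: "poly_integral (\<tau> (i - 1)) (\<tau> i) (e i * m) = 0" if i: "i \<in> {1..N}" and m: "m \<in> polys_below p" for i m
  proof -
    \<comment> \<open>The test function that equals \<open>m\<close> on element \<open>i\<close> and vanishes on all others.\<close>
    let ?m = "\<lambda>j. if j = i then m else 0"
    have "piecewise ?m \<in> dSt \<tau> N p"
      by (rule dStI[OF _ pieces_piecewise]) (use m in \<open>auto simp: polys_below_def\<close>)
    then have "0 = (\<Sum>j=1..N. poly_integral (\<tau> (j - 1)) (\<tau> j) (e j * ?m j))"
      using orth pieces_l2_inner[OF e(3) pieces_piecewise] by metis
    also have "\<dots> = (\<Sum>j=1..N. if j = i then poly_integral (\<tau> (i - 1)) (\<tau> i) (e i * m) else 0)"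
      by (rule sum.cong) (auto simp: poly_integral_0)
    finally show ?thesis
      using i by simp
  qed
  have node: "i \<le> N \<Longrightarrow> \<psi> (\<tau> i) = 0 \<and> (0 < i \<longrightarrow> e i = 0)" for i
  proof (induction i)
    case 0
    then show ?case using \<psi>(2) by simp
  next
    case (Suc i)
    then have i: "Suc i \<in> {1..N}" by auto
    have less: "\<tau> i < \<tau> (Suc i)"
      using node_step Suc.prems by simp
    have "poly (e (Suc i)) (\<tau> i) = 0"
      using e(2)[OF i, of "\<tau> i"] Suc less by simp
    then have "e (Suc i) = 0"
      using poly_reconstruction_unique[OF less e(1)[OF i]] local[OF i] by simp
    then show ?case
      using e(2)[OF i, of "\<tau> (Suc i)"] less by simp
  qed
  show ?thesis
  proof (cases "t \<in> \<tau> ` {..N}")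
    case True
    then show ?thesis using node by auto
  next
    case False
    then obtain i where "i \<in> {1..N}" "t \<in> {\<tau> (i - 1)<..<\<tau> i}"
      using element_of[OF t] by metis
    then show ?thesis
      using e(2)[of i t] node[of i] by auto
  qed
qed

text \<open>
  The projection is still onto when the terminal value 0 is prescribed. Take the reconstruction \<open>\<psi>\<close>
  and a function \<open>\<omega>\<close> orthogonal to the discontinuous space with initial value 1. Its derivative belongs
  to that space, hence integration by parts of \<open>\<omega>\<close> against itself shows \<open>\<omega>(T)\<^sup>2 = \<omega>(0)\<^sup>2 = 1\<close>, and a
  multiple of \<open>\<omega>\<close> removes the terminal value of \<open>\<psi>\<close> without changing its projection.
\<close>
lemma St0_lift:
  assumes \<eta>: "\<eta> \<in> dSt \<tau> N p"
  shows "\<exists>\<psi>\<in>St0 \<tau> N p. \<forall>\<eta>'\<in>dSt \<tau> N p. l2_inner J \<psi> \<eta>' = l2_inner J \<eta> \<eta>'"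
proof -
  have 0: "(\<lambda>t. 0) \<in> dSt \<tau> N p"
    by (rule dStI[of "\<lambda>_. 0"]) (auto simp: polys_below_def pieces_def)
  obtain \<psi> where \<psi>: "\<psi> \<in> St \<tau> N p" "\<And>\<eta>'. \<eta>' \<in> dSt \<tau> N p \<Longrightarrow> l2_inner J \<psi> \<eta>' = l2_inner J \<eta> \<eta>'"
    using St_reconstruction[OF \<eta>, of 0] by blast
  obtain \<omega> where \<omega>: "\<omega> \<in> St \<tau> N p" "\<omega> (\<tau> 0) = 1" "\<And>\<eta>'. \<eta>' \<in> dSt \<tau> N p \<Longrightarrow> l2_inner J \<omega> \<eta>' = 0"
    using St_reconstruction[OF 0, of 1] by (auto simp: l2_inner_real)
  have "(\<omega> (\<tau> N))\<^sup>2 = 1"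
    using St_integration_by_parts[OF \<omega>(1,1)] \<omega>(3)[OF deriv_dSt[OF \<omega>(1)]] \<omega>(2) l2_inner_commute[of J "deriv \<omega>" \<omega>]
    by (simp add: power2_eq_square)
  then have nz: "\<omega> (\<tau> N) \<noteq> 0" by auto
  define a where "a = - \<psi> (\<tau> N) / \<omega> (\<tau> N)"
  have "\<psi> (\<tau> N) + a * \<omega> (\<tau> N) = 0"
    using nz by (simp add: a_def)
  then have mem: "(\<lambda>t. \<psi> t + a * \<omega> t) \<in> St0 \<tau> N p"
    unfolding St0_def using St_lincomb[OF \<psi>(1) \<omega>(1), of a] by simp
  have "l2_inner J (\<lambda>t. \<psi> t + a * \<omega> t) \<eta>' = l2_inner J \<eta> \<eta>'" if \<eta>': "\<eta>' \<in> dSt \<tau> N p" for \<eta>'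
  proof -
    have L2: "\<psi> \<in> L2 J" "\<omega> \<in> L2 J" "\<eta>' \<in> L2 J"
      using \<psi>(1) \<omega>(1) \<eta>' St_L2 dSt_L2 by blast+
    have "l2_inner J (\<lambda>t. \<psi> t + a * \<omega> t) \<eta>' = l2_inner J \<psi> \<eta>' + a * l2_inner J \<omega> \<eta>'"
      using L2_mult_integrable[OF L2(1,3)] L2_mult_integrable[OF L2(2,3)]
      by (simp add: l2_inner_real distrib_right mult.assoc)
    then show ?thesis
      using \<psi>(2) \<omega>(3) \<eta>' by simp
  qed
  then show ?thesis
    using mem by blast
qed

end

section \<open>Invariance of the schemes under changes on null sets\<close>

text \<open>
  The property defining the chosen gradient involves the function only through integrals, so the very
  same representative is chosen for both functions.
\<close>
lemma gradient_x_cong_AE: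
  assumes D: "open D" and eq: "AE z in lebesgue_on (cylinder D T). U z = U' z"
  shows "gradient_x D T U = gradient_x D T U'"
proof -
  have "cylinder D T \<in> sets lebesgue"
    unfolding cylinder_def using open_Times[OF D open_greaterThanLessThan[of 0 T]] by simp
  then have "l2_inner (cylinder D T) U f = l2_inner (cylinder D T) U' f" for f
    by (rule l2_inner_cong_AE) (use eq in auto)
  then show ?thesis
    unfolding gradient_x_def weak_deriv_def by simp
qed

lemma l1l2_pairing_cong_AE:
  assumes D: "open D" and eq: "AE z in lebesgue_on (cylinder D T). W z = W' z"
  shows "l1l2_pairing D T F W = l1l2_pairing D T F W'"
proof -
  have "AE t in lebesgue_on {0<..<T}. AE x in lebesgue_on D. W (x, t) = W' (x, t)"
    using AE_Times_slices(2)[OF D open_greaterThanLessThan] eq unfolding cylinder_def .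
  then have "AE t in lebesgue_on {0<..<T}. l2_inner D (\<lambda>x. F (x, t)) (\<lambda>x. W (x, t))
      = l2_inner D (\<lambda>x. F (x, t)) (\<lambda>x. W' (x, t))"
    by eventually_elim (use D in \<open>auto intro: l2_inner_cong_AE\<close>)
  then show ?thesis
    unfolding l1l2_pairing_def by (intro integral_cong_AE_lebesgue_on(2)) auto
qed

section \<open>The temporal projection on the space-time cylinder\<close>

locale space_time_mesh = time_mesh \<tau> N for \<tau> N +
  fixes D :: "'a::euclidean_space set" and T :: real and p :: nat
  assumes open_D: "open D" and first_node: "\<tau> 0 = 0" and last_node: "\<tau> N = T"
begin

abbreviation Q :: "('a \<times> real) set" where "Q \<equiv> cylinder D T"

lemma Q_eq: "Q = D \<times> J"
  by (simp add: cylinder_def first_node last_node)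

lemma open_Q: "open Q"
  unfolding Q_eq by (intro open_Times open_D open_greaterThanLessThan)

lemma Q_sets: "Q \<in> sets lebesgue"
  using open_Q by simp

lemma tensor_dSt_L2: "A \<subseteq> L2 D \<Longrightarrow> U \<in> tensor A (dSt \<tau> N p) \<Longrightarrow> U \<in> L2 Q"
  unfolding Q_eq
  by (intro tensor_L2 open_D open_greaterThanLessThan) (use tensor_mono[OF _ dSt_L2] in blast)

text \<open>
  At the nodes the derivative of the sum may differ from the sum of the derivatives, which need not exist
  there; hence the claim holds only off a null set.
\<close>
lemma time_deriv_sum_AE:
  assumes "\<And>i. i \<in> I \<Longrightarrow> \<psi> i \<in> St \<tau> N p"
  shows "AE z in lebesgue_on Q. time_deriv (\<lambda>z. \<Sum>i\<in>I. \<phi> i (fst z) * \<psi> i (snd z)) z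
    = (\<Sum>i\<in>I. \<phi> i (fst z) * deriv (\<psi> i) (snd z))"
proof -
  have "deriv (\<lambda>s. \<Sum>i\<in>I. \<phi> i x * \<psi> i s) t = (\<Sum>i\<in>I. \<phi> i x * deriv (\<psi> i) t)"
    if "k \<in> {1..N}" "t \<in> {\<tau> (k - 1)<..<\<tau> k}" for k t x
    by (rule DERIV_imp_deriv, rule DERIV_sum)
      (use St_differentiable[OF assms that] in \<open>auto intro: DERIV_cmult\<close>)
  then have "AE t in lebesgue_on J. \<forall>x. deriv (\<lambda>s. \<Sum>i\<in>I. \<phi> i x * \<psi> i s) t = (\<Sum>i\<in>I. \<phi> i x * deriv (\<psi> i) t)"
    by (intro AE_elements) blast
  from AE_Times_snd[OF open_D open_greaterThanLessThan this] show ?thesis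
    unfolding Q_eq by eventually_elim (simp add: time_deriv_def case_prod_beta')
qed

lemma time_deriv_tensor:
  assumes "U \<in> tensor A (St \<tau> N p)"
  shows "\<exists>U'\<in>tensor A (dSt \<tau> N p). AE z in lebesgue_on Q. time_deriv U z = U' z"
proof -
  obtain n \<phi> \<psi> where U: "\<And>i. i \<in> {..<n::nat} \<Longrightarrow> \<phi> i \<in> A" "\<And>i. i \<in> {..<n} \<Longrightarrow> \<psi> i \<in> St \<tau> N p"
    "U = (\<lambda>z. \<Sum>i<n. \<phi> i (fst z) * \<psi> i (snd z))"
    by (rule tensorE[OF assms]) (rule that; assumption)
  show ?thesis
  proof
    show "AE z in lebesgue_on Q. time_deriv U z = (\<Sum>i<n. \<phi> i (fst z) * deriv (\<psi> i) (snd z))"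
      unfolding U(3) by (rule time_deriv_sum_AE) (use U in auto)
    show "(\<lambda>z. \<Sum>i<n. \<phi> i (fst z) * deriv (\<psi> i) (snd z)) \<in> tensor A (dSt \<tau> N p)"
      by (rule tensorI) (use U deriv_dSt in auto)
  qed
qed

text \<open>
  Taking antiderivatives factor by factor: the time derivatives of continuous piecewise polynomial
  functions exhaust the discontinuous space up to null sets.
\<close>
lemma tensor_antiderivative:
  assumes "X \<in> tensor A (dSt \<tau> N p)"
  shows "\<exists>W\<in>tensor A (St \<tau> N p). AE z in lebesgue_on Q. time_deriv W z = X z"
proof -
  obtain n \<phi> \<eta> where X: "\<And>i. i \<in> {..<n::nat} \<Longrightarrow> \<phi> i \<in> A" "\<And>i. i \<in> {..<n} \<Longrightarrow> \<eta> i \<in> dSt \<tau> N p"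
    "X = (\<lambda>z. \<Sum>i<n. \<phi> i (fst z) * \<eta> i (snd z))"
    by (rule tensorE[OF assms]) (rule that; assumption)
  have "\<forall>i\<in>{..<n}. \<exists>\<psi>. \<psi> \<in> St \<tau> N p \<and> (\<forall>k\<in>{1..N}. \<forall>t\<in>{\<tau> (k - 1)<..<\<tau> k}. deriv \<psi> t = \<eta> i t)"
    using X(2) by (force simp: dSt_def dest!: DERIV_imp_deriv)
  from bchoice[OF this] obtain \<psi> where \<psi>: "\<And>i. i \<in> {..<n} \<Longrightarrow> \<psi> i \<in> St \<tau> N p"
    "\<And>i k t. i \<in> {..<n} \<Longrightarrow> k \<in> {1..N} \<Longrightarrow> t \<in> {\<tau> (k - 1)<..<\<tau> k} \<Longrightarrow> deriv (\<psi> i) t = \<eta> i t"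
    by blast
  have "AE t in lebesgue_on J. \<forall>i\<in>{..<n}. deriv (\<psi> i) t = \<eta> i t"
    by (rule AE_elements) (use \<psi>(2) in blast)
  from AE_Times_snd[OF open_D open_greaterThanLessThan this]
  have "AE z in lebesgue_on Q. \<forall>i\<in>{..<n}. deriv (\<psi> i) (snd z) = \<eta> i (snd z)"
    unfolding Q_eq .
  moreover have "AE z in lebesgue_on Q. time_deriv (\<lambda>z. \<Sum>i<n. \<phi> i (fst z) * \<psi> i (snd z)) z
      = (\<Sum>i<n. \<phi> i (fst z) * deriv (\<psi> i) (snd z))"
    by (rule time_deriv_sum_AE) (rule \<psi>(1))
  ultimately have "AE z in lebesgue_on Q. time_deriv (\<lambda>z. \<Sum>i<n. \<phi> i (fst z) * \<psi> i (snd z)) z = X z"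
    by eventually_elim (simp add: X(3))
  moreover have "(\<lambda>z. \<Sum>i<n. \<phi> i (fst z) * \<psi> i (snd z)) \<in> tensor A (St \<tau> N p)"
    by (rule tensorI) (use X \<psi> in auto)
  ultimately show ?thesis
    by blast
qed

text \<open>
  The condition defining the temporal projection is orthogonality to the discontinuous space itself.
\<close>
lemma l2_inner_time_deriv_iff:
  "(\<forall>W\<in>tensor A (St \<tau> N p). l2_inner Q P (time_deriv W) = l2_inner Q U (time_deriv W)) \<longleftrightarrow>
   (\<forall>X\<in>tensor A (dSt \<tau> N p). l2_inner Q P X = l2_inner Q U X)"
  (is "?L \<longleftrightarrow> ?R")
proof
  assume L: ?L
  show ?R
  proof
    fix X assume "X \<in> tensor A (dSt \<tau> N p)"
    then obtain W where W: "W \<in> tensor A (St \<tau> N p)" "AE z in lebesgue_on Q. time_deriv W z = X z"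
      using tensor_antiderivative by blast
    have "l2_inner Q Y (time_deriv W) = l2_inner Q Y X" for Y
      by (rule l2_inner_cong_AE[OF Q_sets]) (use W in auto)
    then show "l2_inner Q P X = l2_inner Q U X"
      using L W(1) by metis
  qed
next
  assume R: ?R
  show ?L
  proof
    fix W assume "W \<in> tensor A (St \<tau> N p)"
    then obtain X where X: "X \<in> tensor A (dSt \<tau> N p)" "AE z in lebesgue_on Q. time_deriv W z = X z"
      using time_deriv_tensor by blast
    have "l2_inner Q Y (time_deriv W) = l2_inner Q Y X" for Y
      by (rule l2_inner_cong_AE[OF Q_sets]) (use X in auto)
    then show "l2_inner Q P (time_deriv W) = l2_inner Q U (time_deriv W)"
      using R X(1) by metis
  qed
qed

text \<open>
  The difference \<open>P - P'\<close> is an admissible test function.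
\<close>
lemma tensor_dSt_eq_AE:
  assumes "P \<in> tensor (L2 D) (dSt \<tau> N p)" "P' \<in> tensor (L2 D) (dSt \<tau> N p)"
    and eq: "\<And>X. X \<in> tensor (L2 D) (dSt \<tau> N p) \<Longrightarrow> l2_inner Q P X = l2_inner Q P' X"
  shows "AE z in lebesgue_on Q. P z = P' z"
proof -
  have "(\<lambda>z. - P' z) \<in> tensor (L2 D) (dSt \<tau> N p)"
    using assms(2) L2_scale[of _ D "-1"] by (intro tensor_uminus) auto
  from tensor_add[OF assms(1) this]
  have mem: "(\<lambda>z. P z - P' z) \<in> tensor (L2 D) (dSt \<tau> N p)"
    by simp
  have L2: "P \<in> L2 Q" "P' \<in> L2 Q" "(\<lambda>z. P z - P' z) \<in> L2 Q"
    using assms(1,2) mem tensor_dSt_L2 by blast+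
  have "l2_inner Q (\<lambda>z. P z - P' z) (\<lambda>z. P z - P' z) = 0"
    using l2_inner_diff_left[OF L2] eq[OF mem] by simp
  from l2_inner_self_eq_0[OF L2(3) this] show ?thesis
    by simp
qed

lemma tensor_orthogonalI:
  assumes "A \<subseteq> L2 D" "B \<subseteq> L2 D"
    and "\<And>i. i \<in> I \<Longrightarrow> \<phi> i \<in> A" "\<And>i. i \<in> I \<Longrightarrow> \<psi> i \<in> L2 J" "\<And>i. i \<in> I \<Longrightarrow> \<psi>' i \<in> L2 J"
    and eq: "\<And>i \<eta>. i \<in> I \<Longrightarrow> \<eta> \<in> dSt \<tau> N p \<Longrightarrow> l2_inner J (\<psi> i) \<eta> = l2_inner J (\<psi>' i) \<eta>"
    and X: "X \<in> tensor B (dSt \<tau> N p)"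
  shows "l2_inner Q (\<lambda>z. \<Sum>i\<in>I. \<phi> i (fst z) * \<psi> i (snd z)) X
       = l2_inner Q (\<lambda>z. \<Sum>i\<in>I. \<phi> i (fst z) * \<psi>' i (snd z)) X"
proof -
  obtain m \<xi> \<eta> where X: "\<And>j. j \<in> {..<m::nat} \<Longrightarrow> \<xi> j \<in> B" "\<And>j. j \<in> {..<m} \<Longrightarrow> \<eta> j \<in> dSt \<tau> N p"
    "X = (\<lambda>z. \<Sum>j<m. \<xi> j (fst z) * \<eta> j (snd z))"
    by (rule tensorE[OF X]) (rule that; assumption)
  note L2 = subsetD[OF assms(1) assms(3)] subsetD[OF assms(2) X(1)] subsetD[OF dSt_L2 X(2)]
  show ?thesis
    unfolding X(3) Q_eq
    by (subst (1 2) l2_inner_tensor[OF open_D open_greaterThanLessThan])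
      (use L2 assms(4,5) eq X(2) in auto)
qed

text \<open>
  The projection is unique up to null sets, so the one chosen in the definition agrees with any other
  candidate.
\<close>
lemma time_proj_AE:
  assumes P: "P \<in> tensor (L2 D) (dSt \<tau> N p)"
    and orth: "\<And>X. X \<in> tensor (L2 D) (dSt \<tau> N p) \<Longrightarrow> l2_inner Q P X = l2_inner Q U X"
  shows "AE z in lebesgue_on Q. time_proj D T \<tau> N p U z = P z"
proof -
  let ?proj = "\<lambda>P. P \<in> tensor (L2 D) (dSt \<tau> N p) \<and>
    (\<forall>W\<in>tensor (L2 D) (St \<tau> N p). l2_inner Q P (time_deriv W) = l2_inner Q U (time_deriv W))"
  have "?proj P"
    using assms by (auto simp: l2_inner_time_deriv_iff)
  then have "?proj (time_proj D T \<tau> N p U)"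
    unfolding time_proj_def by (rule someI[of ?proj])
  then show ?thesis
    unfolding l2_inner_time_deriv_iff using P orth by (intro tensor_dSt_eq_AE) auto
qed

text \<open>
  Projecting the temporal factors keeps the spatial factors in \<open>A\<close>. The projection defined by choice
  only has spatial factors in \<open>L\<^sup>2(D)\<close>; the lemma makes it, up to null sets, an admissible test function
  of the first order scheme. The last clause says that this representative acts on every time slice
  separately.
\<close>
lemma time_proj_exists:
  assumes A: "A \<subseteq> L2 D" and U: "U \<in> tensor A (St \<tau> N p)"
  shows "\<exists>P\<in>tensor A (dSt \<tau> N p). (AE z in lebesgue_on Q. time_proj D T \<tau> N p U z = P z) \<and>
    (\<forall>X\<in>tensor (L2 D) (dSt \<tau> N p). l2_inner Q P X = l2_inner Q U X) \<and>
    (\<forall>x. \<forall>\<eta>\<in>dSt \<tau> N p. l2_inner J (\<lambda>t. P (x, t)) \<eta> = l2_inner J (\<lambda>t. U (x, t)) \<eta>)"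
proof -
  obtain n \<phi> \<psi> where U: "\<And>i. i \<in> {..<n::nat} \<Longrightarrow> \<phi> i \<in> A" "\<And>i. i \<in> {..<n} \<Longrightarrow> \<psi> i \<in> St \<tau> N p"
    "U = (\<lambda>z. \<Sum>i<n. \<phi> i (fst z) * \<psi> i (snd z))"
    by (rule tensorE[OF U]) (rule that; assumption)
  have "\<forall>i\<in>{..<n}. \<exists>\<pi>. \<pi> \<in> dSt \<tau> N p \<and> (\<forall>\<eta>\<in>dSt \<tau> N p. l2_inner J \<pi> \<eta> = l2_inner J (\<psi> i) \<eta>)"
    using dSt_projection_exists U(2) by blast
  from bchoice[OF this] obtain \<pi> where \<pi>: "\<And>i. i \<in> {..<n} \<Longrightarrow> \<pi> i \<in> dSt \<tau> N p"
    "\<And>i \<eta>. i \<in> {..<n} \<Longrightarrow> \<eta> \<in> dSt \<tau> N p \<Longrightarrow> l2_inner J (\<pi> i) \<eta> = l2_inner J (\<psi> i) \<eta>"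
    by blast
  note L2 = subsetD[OF St_L2 U(2)] subsetD[OF dSt_L2 \<pi>(1)]
  define P where "P = (\<lambda>z. \<Sum>i<n. \<phi> i (fst z) * \<pi> i (snd z))"
  have P: "P \<in> tensor A (dSt \<tau> N p)"
    unfolding P_def by (rule tensorI) (use U \<pi> in auto)
  have orth: "l2_inner Q P X = l2_inner Q U X" if "X \<in> tensor (L2 D) (dSt \<tau> N p)" for X
    unfolding P_def U(3) by (rule tensor_orthogonalI[OF A subset_refl U(1) L2(2,1) \<pi>(2) that])
  have "l2_inner J (\<lambda>t. P (x, t)) \<eta> = l2_inner J (\<lambda>t. U (x, t)) \<eta>" if \<eta>: "\<eta> \<in> dSt \<tau> N p" for x \<eta>
  proof -
    have \<eta>L2: "\<eta> \<in> L2 J" using \<eta> dSt_L2 by blast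
    have "l2_inner J (\<lambda>t. \<Sum>i<n. \<phi> i x * f i t) \<eta> = (\<Sum>i<n. \<phi> i x * l2_inner J (f i) \<eta>)"
      if "\<And>i. i \<in> {..<n} \<Longrightarrow> f i \<in> L2 J" for f
      using l2_inner_sum[of "{..<n}" "\<lambda>i t. \<phi> i x * f i t" J "{()}" "\<lambda>_. \<eta>"] that \<eta>L2
        l2_inner_scale[of J _ _ 1 \<eta>] by (simp add: L2_scale)
    from this[of \<pi>] this[of \<psi>] show ?thesis
      using L2 \<pi>(2)[OF _ \<eta>] by (simp add: P_def U(3))
  qed
  then show ?thesis
    using P orth time_proj_AE[of P U] tensor_mono[OF A subset_refl, of "dSt \<tau> N p"] by blast
qed

lemma time_proj_surj:
  assumes A: "A \<subseteq> L2 D" and X: "X \<in> tensor A (dSt \<tau> N p)"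
  shows "\<exists>W\<in>tensor A (St0 \<tau> N p). AE z in lebesgue_on Q. time_proj D T \<tau> N p W z = X z"
proof -
  obtain n \<phi> \<eta> where X': "\<And>i. i \<in> {..<n::nat} \<Longrightarrow> \<phi> i \<in> A" "\<And>i. i \<in> {..<n} \<Longrightarrow> \<eta> i \<in> dSt \<tau> N p"
    "X = (\<lambda>z. \<Sum>i<n. \<phi> i (fst z) * \<eta> i (snd z))"
    by (rule tensorE[OF X]) (rule that; assumption)
  have "\<forall>i\<in>{..<n}. \<exists>\<psi>. \<psi> \<in> St0 \<tau> N p \<and> (\<forall>\<zeta>\<in>dSt \<tau> N p. l2_inner J \<psi> \<zeta> = l2_inner J (\<eta> i) \<zeta>)"
    using St0_lift X'(2) by blast
  from bchoice[OF this] obtain \<psi> where \<psi>: "\<And>i. i \<in> {..<n} \<Longrightarrow> \<psi> i \<in> St0 \<tau> N p"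
    "\<And>i \<zeta>. i \<in> {..<n} \<Longrightarrow> \<zeta> \<in> dSt \<tau> N p \<Longrightarrow> l2_inner J (\<psi> i) \<zeta> = l2_inner J (\<eta> i) \<zeta>"
    by blast
  have L2: "\<psi> i \<in> L2 J" "\<eta> i \<in> L2 J" if "i \<in> {..<n}" for i
    using \<psi>(1)[OF that] X'(2)[OF that] St_L2 dSt_L2 by (auto simp: St0_def)
  let ?W = "\<lambda>z. \<Sum>i<n. \<phi> i (fst z) * \<psi> i (snd z)"
  have "?W \<in> tensor A (St0 \<tau> N p)"
    by (rule tensorI) (use X' \<psi> in auto)
  moreover have "l2_inner Q X Y = l2_inner Q ?W Y" if "Y \<in> tensor (L2 D) (dSt \<tau> N p)" for Y
    unfolding X'(3) by (rule tensor_orthogonalI[OF A subset_refl X'(1) L2(2,1) \<psi>(2)[symmetric] that])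
  then have "AE z in lebesgue_on Q. time_proj D T \<tau> N p ?W z = X z"
    using X tensor_mono[OF A subset_refl, of "dSt \<tau> N p"] by (intro time_proj_AE) auto
  ultimately show ?thesis
    by blast
qed

section \<open>The reconstructed velocity and the second order term\<close>

text \<open>
  The temporal factors of \<open>\<partial>\<^sub>tU\<close> are reconstructed with initial value 0. The initial datum \<open>v\<close> enters as
  one more tensor, whose temporal factor has initial value 1 and projection 0.
\<close>
lemma velocity_exists:
  assumes A: "A \<subseteq> L2 D" and U: "U \<in> tensor A (St \<tau> N p)" and v: "v \<in> A"
  shows "\<exists>V\<in>tensor A (St \<tau> N p). (AE z in lebesgue_on Q. time_proj D T \<tau> N p V z = time_deriv U z) \<and>
    (\<forall>x. V (x, 0) = v x)"
proof -
  obtain U' where U': "U' \<in> tensor A (dSt \<tau> N p)" "AE z in lebesgue_on Q. time_deriv U z = U' z"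
    using time_deriv_tensor[OF U] by blast
  obtain n \<phi> \<eta> where X: "\<And>i. i \<in> {..<n::nat} \<Longrightarrow> \<phi> i \<in> A" "\<And>i. i \<in> {..<n} \<Longrightarrow> \<eta> i \<in> dSt \<tau> N p"
    "U' = (\<lambda>z. \<Sum>i<n. \<phi> i (fst z) * \<eta> i (snd z))"
    by (rule tensorE[OF U'(1)]) (rule that; assumption)
  \<comment> \<open>The index \<open>n\<close> carries the additional tensor for the initial datum.\<close>
  define \<phi>' where "\<phi>' i = (if i < n then \<phi> i else v)" for i
  define \<eta>' where "\<eta>' i = (if i < n then \<eta> i else (\<lambda>_. 0))" for i
  have zero: "(\<lambda>_. 0) \<in> dSt \<tau> N p"
    by (rule dStI[of "\<lambda>_. 0"]) (auto simp: polys_below_def pieces_def)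
  have \<phi>': "\<And>i. i \<in> {..<Suc n} \<Longrightarrow> \<phi>' i \<in> A" and \<eta>': "\<And>i. i \<in> {..<Suc n} \<Longrightarrow> \<eta>' i \<in> dSt \<tau> N p"
    using X(1,2) v zero by (auto simp: \<phi>'_def \<eta>'_def)
  have U'_eq: "U' = (\<lambda>z. \<Sum>i<Suc n. \<phi>' i (fst z) * \<eta>' i (snd z))"
    by (simp add: X(3) \<phi>'_def \<eta>'_def)
  have "\<forall>i\<in>{..<Suc n}. \<exists>\<psi>. \<psi> \<in> St \<tau> N p \<and> \<psi> 0 = (if i < n then 0 else 1) \<and>
      (\<forall>\<zeta>\<in>dSt \<tau> N p. l2_inner J \<psi> \<zeta> = l2_inner J (\<eta>' i) \<zeta>)"
    using St_reconstruction[OF \<eta>'] unfolding first_node by blast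
  from bchoice[OF this] obtain \<psi> where \<psi>: "\<And>i. i \<in> {..<Suc n} \<Longrightarrow> \<psi> i \<in> St \<tau> N p"
    "\<And>i. i \<in> {..<Suc n} \<Longrightarrow> \<psi> i 0 = (if i < n then 0 else 1)"
    "\<And>i \<zeta>. i \<in> {..<Suc n} \<Longrightarrow> \<zeta> \<in> dSt \<tau> N p \<Longrightarrow> l2_inner J (\<psi> i) \<zeta> = l2_inner J (\<eta>' i) \<zeta>"
    by blast
  note L2 = subsetD[OF St_L2 \<psi>(1)] subsetD[OF dSt_L2 \<eta>']
  let ?V = "\<lambda>z. \<Sum>i<Suc n. \<phi>' i (fst z) * \<psi> i (snd z)"
  have "?V \<in> tensor A (St \<tau> N p)"
    by (rule tensorI) (use \<phi>' \<psi> in auto)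
  moreover have "l2_inner Q U' Y = l2_inner Q ?V Y" if "Y \<in> tensor (L2 D) (dSt \<tau> N p)" for Y
    unfolding U'_eq by (rule tensor_orthogonalI[OF A subset_refl \<phi>' L2(2,1) \<psi>(3)[symmetric] that])
  then have "AE z in lebesgue_on Q. time_proj D T \<tau> N p ?V z = U' z"
    using U'(1) tensor_mono[OF A subset_refl, of "dSt \<tau> N p"] by (intro time_proj_AE) auto
  with U'(2) have "AE z in lebesgue_on Q. time_proj D T \<tau> N p ?V z = time_deriv U z"
    by eventually_elim simp
  moreover have "?V (x, 0) = v x" for x
    using \<psi>(2) by (simp add: \<phi>'_def)
  ultimately show ?thesis
    by blast
qed

lemma tensor_slice_St:
  assumes "V \<in> tensor A (St \<tau> N p)"
  shows "(\<lambda>t. V (x, t)) \<in> St \<tau> N p"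
proof -
  obtain n \<phi> \<psi> where V: "\<And>i. i \<in> {..<n::nat} \<Longrightarrow> \<phi> i \<in> A" "\<And>i. i \<in> {..<n} \<Longrightarrow> \<psi> i \<in> St \<tau> N p"
    "V = (\<lambda>z. \<Sum>i<n. \<phi> i (fst z) * \<psi> i (snd z))"
    by (rule tensorE[OF assms]) (rule that; assumption)
  have "m \<le> n \<Longrightarrow> (\<lambda>t. \<Sum>i<m. \<phi> i x * \<psi> i t) \<in> St \<tau> N p" for m
  proof (induction m)
    case 0
    have "\<exists>q. degree q \<le> p \<and> (\<forall>t\<in>B. 0 = poly q t)" for B :: "real set"
      by (rule exI[of _ 0]) simp
    then show ?case by (simp add: St_def)
  next
    case (Suc m)
    then show ?case
      using St_lincomb[of _ p "\<psi> m" "\<phi> m x"] V(2)[of m] by simp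
  qed
  then show ?thesis
    by (simp add: V(3))
qed

text \<open>
  By the theorem of Fubini, for almost every \<open>x\<close> the two time slices have the same projection and the
  same initial value, so uniqueness in the time variable applies to their difference.
\<close>
lemma velocity_unique:
  assumes V: "V \<in> tensor (L2 D) (St \<tau> N p)" and V': "V' \<in> tensor (L2 D) (St \<tau> N p)"
    and proj: "AE z in lebesgue_on Q. time_proj D T \<tau> N p V z = time_proj D T \<tau> N p V' z"
    and init: "AE x in lebesgue_on D. V (x, 0) = V' (x, 0)"
  shows "AE z in lebesgue_on Q. V z = V' z"
proof -
  obtain P where P: "P \<in> tensor (L2 D) (dSt \<tau> N p)" "AE z in lebesgue_on Q. time_proj D T \<tau> N p V z = P z"
    "\<And>x \<eta>. \<eta> \<in> dSt \<tau> N p \<Longrightarrow> l2_inner J (\<lambda>t. P (x, t)) \<eta> = l2_inner J (\<lambda>t. V (x, t)) \<eta>"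
    using time_proj_exists[OF subset_refl V] by blast
  obtain P' where P': "P' \<in> tensor (L2 D) (dSt \<tau> N p)" "AE z in lebesgue_on Q. time_proj D T \<tau> N p V' z = P' z"
    "\<And>x \<eta>. \<eta> \<in> dSt \<tau> N p \<Longrightarrow> l2_inner J (\<lambda>t. P' (x, t)) \<eta> = l2_inner J (\<lambda>t. V' (x, t)) \<eta>"
    using time_proj_exists[OF subset_refl V'] by blast
  have "AE z in lebesgue_on (D \<times> J). P z = P' z"
    using proj P(2) P'(2) unfolding Q_eq by eventually_elim simp
  from AE_Times_slices(1)[OF open_D open_greaterThanLessThan this] init
  have "AE x in lebesgue_on D. \<forall>t\<in>J. V (x, t) = V' (x, t)"
  proof eventually_elim
    case (elim x)
    define \<delta> where "\<delta> t = V (x, t) - V' (x, t)" for t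
    have sl: "(\<lambda>t. V (x, t)) \<in> St \<tau> N p" "(\<lambda>t. V' (x, t)) \<in> St \<tau> N p"
      by (rule tensor_slice_St[OF V], rule tensor_slice_St[OF V'])
    have \<delta>: "\<delta> \<in> St \<tau> N p"
      using St_lincomb[OF sl, of "-1"] by (simp add: \<delta>_def[abs_def])
    have "l2_inner J \<delta> \<eta> = 0" if \<eta>: "\<eta> \<in> dSt \<tau> N p" for \<eta>
    proof -
      have "l2_inner J \<delta> \<eta> = l2_inner J (\<lambda>t. V (x, t)) \<eta> - l2_inner J (\<lambda>t. V' (x, t)) \<eta>"
        unfolding \<delta>_def using sl \<eta> St_L2 dSt_L2 by (intro l2_inner_diff_left) blast+
      also have "\<dots> = l2_inner J (\<lambda>t. P (x, t)) \<eta> - l2_inner J (\<lambda>t. P' (x, t)) \<eta>"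
        using P(3) P'(3) \<eta> by simp
      also have "l2_inner J (\<lambda>t. P (x, t)) \<eta> = l2_inner J (\<lambda>t. P' (x, t)) \<eta>"
        by (rule l2_inner_cong_AE) (use elim(1) in auto)
      finally show ?thesis by simp
    qed
    then have "\<delta> t = 0" if "t \<in> J" for t
      by (rule St_orthogonal_eq_0[OF \<delta>, rotated])
        (use elim(2) that in \<open>auto simp: \<delta>_def first_node\<close>)
    then show ?case
      by (simp add: \<delta>_def)
  qed
  from AE_Times_fst[OF open_D open_greaterThanLessThan this]
  have "AE z in lebesgue_on (D \<times> J). z \<in> D \<times> J \<longrightarrow> V z = V' z"
    by eventually_elim auto
  then show ?thesis
    using open_Q by (simp add: AE_lebesgue_on_iff Q_eq)
qed

lemma tensor_integration_by_parts:
  assumes A: "A \<subseteq> L2 D" and V: "V \<in> tensor A (St \<tau> N p)" and W: "W \<in> tensor A (St0 \<tau> N p)"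
  shows "l2_inner Q (time_deriv V) W + l2_inner Q V (time_deriv W) = - l2_inner D (\<lambda>x. V (x, 0)) (\<lambda>x. W (x, 0))"
proof -
  obtain n \<phi> \<psi> where V': "\<And>i. i \<in> {..<n::nat} \<Longrightarrow> \<phi> i \<in> A" "\<And>i. i \<in> {..<n} \<Longrightarrow> \<psi> i \<in> St \<tau> N p"
    "V = (\<lambda>z. \<Sum>i<n. \<phi> i (fst z) * \<psi> i (snd z))"
    by (rule tensorE[OF V]) (rule that; assumption)
  obtain m \<xi> \<zeta> where W': "\<And>i. i \<in> {..<m::nat} \<Longrightarrow> \<xi> i \<in> A" "\<And>i. i \<in> {..<m} \<Longrightarrow> \<zeta> i \<in> St0 \<tau> N p"
    "W = (\<lambda>z. \<Sum>i<m. \<xi> i (fst z) * \<zeta> i (snd z))"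
    by (rule tensorE[OF W]) (rule that; assumption)
  have \<zeta>: "\<zeta> j \<in> St \<tau> N p" "\<zeta> j (\<tau> N) = 0" if "j \<in> {..<m}" for j
    using W'(2)[OF that] by (auto simp: St0_def)
  note L2 = subsetD[OF A V'(1)] subsetD[OF A W'(1)] subsetD[OF St_L2 V'(2)] subsetD[OF St_L2 \<zeta>(1)]
    subsetD[OF dSt_L2 deriv_dSt[OF V'(2)]] subsetD[OF dSt_L2 deriv_dSt[OF \<zeta>(1)]]
  have 1: "l2_inner Q (time_deriv V) W = (\<Sum>i<n. \<Sum>j<m. l2_inner D (\<phi> i) (\<xi> j) * l2_inner J (deriv (\<psi> i)) (\<zeta> j))"
  proof -
    have "l2_inner Q (time_deriv V) W = l2_inner Q (\<lambda>z. \<Sum>i<n. \<phi> i (fst z) * deriv (\<psi> i) (snd z)) W"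
      unfolding V'(3) by (rule l2_inner_cong_AE[OF Q_sets time_deriv_sum_AE]) (use V' in auto)
    also have "\<dots> = (\<Sum>i<n. \<Sum>j<m. l2_inner D (\<phi> i) (\<xi> j) * l2_inner J (deriv (\<psi> i)) (\<zeta> j))"
      unfolding W'(3) Q_eq by (rule l2_inner_tensor[OF open_D open_greaterThanLessThan]) (use L2 in auto)
    finally show ?thesis .
  qed
  have 2: "l2_inner Q V (time_deriv W) = (\<Sum>i<n. \<Sum>j<m. l2_inner D (\<phi> i) (\<xi> j) * l2_inner J (\<psi> i) (deriv (\<zeta> j)))"
  proof -
    have "l2_inner Q V (time_deriv W) = l2_inner Q V (\<lambda>z. \<Sum>j<m. \<xi> j (fst z) * deriv (\<zeta> j) (snd z))"
      unfolding W'(3) by (rule l2_inner_cong_AE[OF Q_sets _ time_deriv_sum_AE]) (use \<zeta> in auto)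
    also have "\<dots> = (\<Sum>i<n. \<Sum>j<m. l2_inner D (\<phi> i) (\<xi> j) * l2_inner J (\<psi> i) (deriv (\<zeta> j)))"
      unfolding V'(3) Q_eq by (rule l2_inner_tensor[OF open_D open_greaterThanLessThan]) (use L2 in auto)
    finally show ?thesis .
  qed
  have 3: "l2_inner D (\<lambda>x. V (x, 0)) (\<lambda>x. W (x, 0)) = (\<Sum>i<n. \<Sum>j<m. l2_inner D (\<phi> i) (\<xi> j) * (\<psi> i 0 * \<zeta> j 0))"
  proof -
    have "l2_inner D (\<lambda>x. V (x, 0)) (\<lambda>x. W (x, 0))
        = l2_inner D (\<lambda>x. \<Sum>i<n. \<psi> i 0 * \<phi> i x) (\<lambda>x. \<Sum>j<m. \<zeta> j 0 * \<xi> j x)"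
      by (simp add: V'(3) W'(3) mult.commute)
    also have "\<dots> = (\<Sum>i<n. \<Sum>j<m. l2_inner D (\<lambda>x. \<psi> i 0 * \<phi> i x) (\<lambda>x. \<zeta> j 0 * \<xi> j x))"
      by (rule l2_inner_sum) (use L2 in \<open>auto intro: L2_scale\<close>)
    finally show ?thesis
      by (simp only: l2_inner_scale) (simp add: mult_ac)
  qed
  have 4: "l2_inner J (deriv (\<psi> i)) (\<zeta> j) + l2_inner J (\<psi> i) (deriv (\<zeta> j)) = - (\<psi> i 0 * \<zeta> j 0)"
    if "i \<in> {..<n}" "j \<in> {..<m}" for i j
    using St_integration_by_parts[OF V'(2)[OF that(1)] \<zeta>(1)[OF that(2)]] \<zeta>(2)[OF that(2)]
    by (simp add: first_node)
  have "l2_inner Q (time_deriv V) W + l2_inner Q V (time_deriv W)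
      = (\<Sum>i<n. \<Sum>j<m. l2_inner D (\<phi> i) (\<xi> j) * (l2_inner J (deriv (\<psi> i)) (\<zeta> j) + l2_inner J (\<psi> i) (deriv (\<zeta> j))))"
    unfolding 1 2 by (simp add: sum.distrib distrib_left)
  also have "\<dots> = (\<Sum>i<n. \<Sum>j<m. l2_inner D (\<phi> i) (\<xi> j) * - (\<psi> i 0 * \<zeta> j 0))"
    by (intro sum.cong refl) (simp only: 4)
  also have "\<dots> = - l2_inner D (\<lambda>x. V (x, 0)) (\<lambda>x. W (x, 0))"
    unfolding 3 by (simp add: sum_negf)
  finally show ?thesis .
qed

text \<open>
  The first equation of the first order scheme turns the term with two time derivatives into the one
  with the derivative of the velocity.
\<close>
lemma second_order_term:
  assumes A: "A \<subseteq> L2 D" and U: "U \<in> tensor A (St \<tau> N p)" and V: "V \<in> tensor A (St \<tau> N p)"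
    and W: "W \<in> tensor A (St0 \<tau> N p)"
    and first: "\<And>\<eta>. \<eta> \<in> tensor A (dSt \<tau> N p) \<Longrightarrow> l2_inner Q (time_deriv U) \<eta> = l2_inner Q V \<eta>"
    and init: "AE x in lebesgue_on D. V (x, 0) = v x"
  shows "- l2_inner Q (time_deriv U) (time_deriv W)
    = l2_inner Q (time_deriv V) (time_proj D T \<tau> N p W) + l2_inner D v (\<lambda>x. W (x, 0))"
proof -
  have W_St: "W \<in> tensor A (St \<tau> N p)"
    using W tensor_mono[of A A "St0 \<tau> N p" "St \<tau> N p"] by (auto simp: St0_def)
  obtain W' where W': "W' \<in> tensor A (dSt \<tau> N p)" "AE z in lebesgue_on Q. time_deriv W z = W' z"
    using time_deriv_tensor[OF W_St] by blast
  obtain V' where V': "V' \<in> tensor A (dSt \<tau> N p)" "AE z in lebesgue_on Q. time_deriv V z = V' z"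
    using time_deriv_tensor[OF V] by blast
  obtain P where P: "AE z in lebesgue_on Q. time_proj D T \<tau> N p W z = P z"
    "\<And>X. X \<in> tensor (L2 D) (dSt \<tau> N p) \<Longrightarrow> l2_inner Q P X = l2_inner Q W X"
    using time_proj_exists[OF A W_St] by blast
  have V'_L2: "V' \<in> tensor (L2 D) (dSt \<tau> N p)"
    using V'(1) tensor_mono[OF A subset_refl] by blast
  have "l2_inner Q (time_deriv U) (time_deriv W) = l2_inner Q (time_deriv U) W'"
    by (rule l2_inner_cong_AE[OF Q_sets]) (use W' in auto)
  also have "\<dots> = l2_inner Q V W'"
    by (rule first[OF W'(1)])
  also have "\<dots> = l2_inner Q V (time_deriv W)"
    by (rule l2_inner_cong_AE[OF Q_sets]) (use W'(2) in auto)
  finally have 1: "l2_inner Q (time_deriv U) (time_deriv W) = l2_inner Q V (time_deriv W)" .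
  have "l2_inner Q (time_deriv V) (time_proj D T \<tau> N p W) = l2_inner Q V' P"
    by (rule l2_inner_cong_AE[OF Q_sets]) (use V' P in auto)
  also have "\<dots> = l2_inner Q V' W"
    using P(2)[OF V'_L2] by (simp add: l2_inner_commute)
  also have "\<dots> = l2_inner Q (time_deriv V) W"
    by (rule l2_inner_cong_AE[OF Q_sets]) (use V'(2) in auto)
  finally have 2: "l2_inner Q (time_deriv V) (time_proj D T \<tau> N p W) = l2_inner Q (time_deriv V) W" .
  have 3: "l2_inner D (\<lambda>x. V (x, 0)) (\<lambda>x. W (x, 0)) = l2_inner D v (\<lambda>x. W (x, 0))"
    by (rule l2_inner_cong_AE) (use open_D init in auto)
  show ?thesis
    using tensor_integration_by_parts[OF A V W] 1 2 3 by simp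
qed

end

section \<open>Equivalence of the two schemes\<close>

theorem proposition3p4:
  fixes \<Omega> :: "(real^'d) set" and T :: real
    and c U0 V0 U0h V0h :: "real^'d \<Rightarrow> real" and c0 :: real
    and F :: "(real^'d) \<times> real \<Rightarrow> real" and g :: "real \<Rightarrow> real"
    and \<K> :: "(real^'d) set set" and \<sigma> hx :: real and px :: nat and S :: "(real^'d \<Rightarrow> real) set"
    and \<tau> :: "nat \<Rightarrow> real" and N pt :: nat
  assumes dim: "CARD('d) \<in> {1, 2, 3}"
    and domain: "polytopal_lipschitz_domain \<Omega>"
    and T_pos: "T > 0"
    and c_cont: "continuous_on (closure \<Omega>) c"
    and c_lower: "c0 > 0" "\<And>x. x \<in> \<Omega> \<Longrightarrow> c x \<ge> c0"
    and U0: "U0 \<in> H10 \<Omega>"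
    and V0: "V0 \<in> L2 \<Omega>"
    and F: "F \<in> L1L2 \<Omega> T"
    and g: "continuous_on UNIV g" "g 0 = 0"
    and mesh: "simplicial_mesh \<Omega> \<sigma> hx \<K>"
    and px: "px \<ge> 1"
    and S: "piecewise_polynomial_space \<Omega> \<K> px S"
    and pt: "pt \<ge> 1"
    and nodes: "\<tau> 0 = 0" "\<tau> N = T" "\<And>i. i < N \<Longrightarrow> \<tau> i < \<tau> (Suc i)"
    and U0h: "U0h \<in> S"
      "\<And>W. W \<in> S \<Longrightarrow>
         l2_inner \<Omega> (\<lambda>x. (c x)\<^sup>2 *\<^sub>R weak_gradient \<Omega> U0h x) (weak_gradient \<Omega> W)
         = l2_inner \<Omega> (\<lambda>x. (c x)\<^sup>2 *\<^sub>R weak_gradient \<Omega> U0 x) (weak_gradient \<Omega> W)"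
    and V0h: "V0h \<in> S" "\<And>W. W \<in> S \<Longrightarrow> l2_inner \<Omega> V0h W = l2_inner \<Omega> V0 W"
  shows "(\<forall>U V. first_order_solution \<Omega> T \<tau> N pt S c g F U0h V0h U V \<longrightarrow>
            second_order_solution \<Omega> T \<tau> N pt S c g F U0h V0h U) \<and>
         (\<forall>U. second_order_solution \<Omega> T \<tau> N pt S c g F U0h V0h U \<longrightarrow>
            (\<exists>V. reconstructed_velocity \<Omega> T \<tau> N pt S V0h U V) \<and>
            (\<forall>V V'. reconstructed_velocity \<Omega> T \<tau> N pt S V0h U V \<and>
               reconstructed_velocity \<Omega> T \<tau> N pt S V0h U V' \<longrightarrow>
               (AE z in lebesgue_on (cylinder \<Omega> T). V z = V' z)) \<and>
            (\<forall>V. reconstructed_velocity \<Omega> T \<tau> N pt S V0h U V \<longrightarrow>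
               first_order_solution \<Omega> T \<tau> N pt S c g F U0h V0h U V))"
proof -
  have open_\<Omega>: "open \<Omega>"
    using domain by (simp add: polytopal_lipschitz_domain_def)
  have S_L2: "S \<subseteq> L2 \<Omega>"
    using S by (auto simp: piecewise_polynomial_space_def H10_def H1_def)
  interpret space_time_mesh \<tau> N \<Omega> T pt
    by unfold_locales (use nodes open_\<Omega> in auto)
  let ?\<Pi> = "time_proj \<Omega> T \<tau> N pt"
  let ?first = "\<lambda>U V. \<forall>\<eta>\<in>tensor S (dSt \<tau> N pt). l2_inner Q (time_deriv U) \<eta> - l2_inner Q V \<eta> = 0"
  let ?wave1 = "\<lambda>U V \<mu>. l2_inner Q (time_deriv V) \<mu>
      + l2_inner Q (\<lambda>z. (c (fst z))\<^sup>2 *\<^sub>R gradient_x \<Omega> T U z) (gradient_x \<Omega> T \<mu>)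
      + l2_inner Q (\<lambda>z. g (U z)) \<mu> = l1l2_pairing \<Omega> T F \<mu>"
  let ?wave2 = "\<lambda>U W. - l2_inner Q (time_deriv U) (time_deriv W)
      + l2_inner Q (\<lambda>z. (c (fst z))\<^sup>2 *\<^sub>R gradient_x \<Omega> T U z) (gradient_x \<Omega> T (?\<Pi> W))
      + l2_inner Q (\<lambda>z. g (U z)) (?\<Pi> W)
      = l1l2_pairing \<Omega> T F (?\<Pi> W) + l2_inner \<Omega> V0h (\<lambda>x. W (x, 0))"
  have wave1_cong: "?wave1 U V \<mu> \<longleftrightarrow> ?wave1 U V \<mu>'"
    if "AE z in lebesgue_on Q. \<mu> z = \<mu>' z" for U V \<mu> \<mu>'
  proof -
    have "l2_inner Q f \<mu> = l2_inner Q f \<mu>'" for f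
      by (rule l2_inner_cong_AE[OF Q_sets _ that]) simp
    then show ?thesis
      using gradient_x_cong_AE[OF open_\<Omega> that] l1l2_pairing_cong_AE[OF open_\<Omega> that] by simp
  qed
  have wave_iff: "?wave2 U W \<longleftrightarrow> ?wave1 U V (?\<Pi> W)"
    if "U \<in> tensor S (St \<tau> N pt)" "V \<in> tensor S (St \<tau> N pt)" "W \<in> tensor S (St0 \<tau> N pt)"
      "?first U V" "AE x in lebesgue_on \<Omega>. V (x, 0) = V0h x" for U V W
    using second_order_term[OF S_L2 that(1-3) _ that(5)] that(4) by auto
  have St0_St: "tensor S (St0 \<tau> N pt) \<subseteq> tensor S (St \<tau> N pt)"
    by (rule tensor_mono) (auto simp: St0_def)
  show ?thesis
  proof (intro conjI allI impI)
    fix U V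
    assume "first_order_solution \<Omega> T \<tau> N pt S c g F U0h V0h U V"
    then have U: "U \<in> tensor S (St \<tau> N pt)" and V: "V \<in> tensor S (St \<tau> N pt)"
      and U_init: "AE x in lebesgue_on \<Omega>. U (x, 0) = U0h x" and V_init: "AE x in lebesgue_on \<Omega>. V (x, 0) = V0h x"
      and first: "?first U V" and wave: "\<And>\<mu>. \<mu> \<in> tensor S (dSt \<tau> N pt) \<Longrightarrow> ?wave1 U V \<mu>"
      unfolding first_order_solution_def by blast+
    have "?wave2 U W" if W: "W \<in> tensor S (St0 \<tau> N pt)" for W
    proof -
      obtain P where P: "P \<in> tensor S (dSt \<tau> N pt)" "AE z in lebesgue_on Q. ?\<Pi> W z = P z"
        using time_proj_exists[OF S_L2 subsetD[OF St0_St W]] by blast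
      have "?wave1 U V (?\<Pi> W)"
        using wave1_cong[OF P(2)] wave[OF P(1)] by blast
      then show ?thesis
        using wave_iff[OF U V W first V_init] by blast
    qed
    then show "second_order_solution \<Omega> T \<tau> N pt S c g F U0h V0h U"
      unfolding second_order_solution_def using U U_init by blast
  next
    fix U
    assume "second_order_solution \<Omega> T \<tau> N pt S c g F U0h V0h U"
    then have "U \<in> tensor S (St \<tau> N pt)"
      by (simp add: second_order_solution_def)
    from velocity_exists[OF S_L2 this V0h(1)]
    show "\<exists>V. reconstructed_velocity \<Omega> T \<tau> N pt S V0h U V"
      unfolding reconstructed_velocity_def by auto
  next
    fix U V V'
    assume "reconstructed_velocity \<Omega> T \<tau> N pt S V0h U V \<and> reconstructed_velocity \<Omega> T \<tau> N pt S V0h U V'"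
    then have V: "V \<in> tensor S (St \<tau> N pt)" "V' \<in> tensor S (St \<tau> N pt)"
      and proj: "AE z in lebesgue_on Q. ?\<Pi> V z = time_deriv U z" "AE z in lebesgue_on Q. ?\<Pi> V' z = time_deriv U z"
      and init: "AE x in lebesgue_on \<Omega>. V (x, 0) = V0h x" "AE x in lebesgue_on \<Omega>. V' (x, 0) = V0h x"
      unfolding reconstructed_velocity_def by blast+
    show "AE z in lebesgue_on Q. V z = V' z"
    proof (rule velocity_unique)
      show "V \<in> tensor (L2 \<Omega>) (St \<tau> N pt)" "V' \<in> tensor (L2 \<Omega>) (St \<tau> N pt)"
        using V tensor_mono[OF S_L2 subset_refl] by blast+
      show "AE z in lebesgue_on Q. ?\<Pi> V z = ?\<Pi> V' z"
        using proj by eventually_elim simp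
      show "AE x in lebesgue_on \<Omega>. V (x, 0) = V' (x, 0)"
        using init by eventually_elim simp
    qed
  next
    fix U V
    assume "second_order_solution \<Omega> T \<tau> N pt S c g F U0h V0h U"
    then have U: "U \<in> tensor S (St \<tau> N pt)" and U_init: "AE x in lebesgue_on \<Omega>. U (x, 0) = U0h x"
      and wave: "\<And>W. W \<in> tensor S (St0 \<tau> N pt) \<Longrightarrow> ?wave2 U W"
      unfolding second_order_solution_def by blast+
    assume "reconstructed_velocity \<Omega> T \<tau> N pt S V0h U V"
    then have V: "V \<in> tensor S (St \<tau> N pt)" and proj: "AE z in lebesgue_on Q. ?\<Pi> V z = time_deriv U z"
      and V_init: "AE x in lebesgue_on \<Omega>. V (x, 0) = V0h x"
      unfolding reconstructed_velocity_def by blast+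
    have first: "?first U V"
    proof
      fix \<eta> assume "\<eta> \<in> tensor S (dSt \<tau> N pt)"
      then have \<eta>: "\<eta> \<in> tensor (L2 \<Omega>) (dSt \<tau> N pt)"
        using tensor_mono[OF S_L2 subset_refl] by blast
      obtain P where P: "AE z in lebesgue_on Q. ?\<Pi> V z = P z"
        "\<And>X. X \<in> tensor (L2 \<Omega>) (dSt \<tau> N pt) \<Longrightarrow> l2_inner Q P X = l2_inner Q V X"
        using time_proj_exists[OF S_L2 V] by blast
      have "AE z in lebesgue_on Q. time_deriv U z = P z"
        using proj P(1) by eventually_elim simp
      then have "l2_inner Q (time_deriv U) \<eta> = l2_inner Q P \<eta>"
        by (rule l2_inner_cong_AE[OF Q_sets]) simp
      then show "l2_inner Q (time_deriv U) \<eta> - l2_inner Q V \<eta> = 0"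
        using P(2)[OF \<eta>] by simp
    qed
    have "?wave1 U V \<mu>" if \<mu>: "\<mu> \<in> tensor S (dSt \<tau> N pt)" for \<mu>
    proof -
      obtain W where W: "W \<in> tensor S (St0 \<tau> N pt)" "AE z in lebesgue_on Q. ?\<Pi> W z = \<mu> z"
        using time_proj_surj[OF S_L2 \<mu>] by blast
      have "?wave1 U V (?\<Pi> W)"
        using wave_iff[OF U V W(1) first V_init] wave[OF W(1)] by blast
      then show ?thesis
        using wave1_cong[OF W(2)] by blast
    qed
    then show "first_order_solution \<Omega> T \<tau> N pt S c g F U0h V0h U V"
      unfolding first_order_solution_def using U V U_init V_init first by blast
  qed
qed

end
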